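(* Let $f$ be of either ignition type or general KPP type. Then there exists a constant $C>0$ that depends on the function $f$ but not on $u$ such that the following holds. Let $u(y)\in C^1[0,H]$ satisfy $\int_0^Hu(y)\,dy=0$, and let $T(x,y,t)=U(x-ct,y)$ be a traveling front solution, with speed $c$, of $$T_t+u(y)T_x=\kappa\Delta T+\frac{v_0^2}\kappa f(T)\ \text{ in }\mathbb R\times[0,H]$$ with either Neumann or periodic boundary conditions in $y$. Then for any collection of intervals $I_j=(c_j-h_j,c_j+h_j)\subset[0,H]$ such that $\frac12\|u\|_{\infty,j}\le|u(y)|\le\|u\|_{\infty,j}$ for $y\in I_j$, where $\|u\|_{\infty,j}=\sup_{I_j}|u|$, one has $$c\ge C\left(v_0+\sum_j\left(1+\frac l{h_j}\right)^{-1}\int_{c_j-h_j}^{c_j+h_j}|u(y)|\frac{dy}H\right),\qquad l=\frac\kappa{v_0}.$$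
   Context: $\kappa,v_0,H>0$ are constants. The nonlinearity $f\in C^1[0,1]$ satisfies $f(0)=f(1)=0$, $f\ge0$ on $(0,1)$, $f\not\equiv0$. General KPP type: $f>0$ on $(0,1)$. Ignition type: for some $\theta_0\in(0,1)$, $f=0$ on $[0,\theta_0]$ and at $1$, $f>0$ on $(\theta_0,1)$. A traveling front solution $U(s,y)$, $s=x-ct$, takes values in $[0,1]$ and satisfies $U(s,y)\to1$ as $s\to-\infty$, $U(s,y)\to0$ as $s\to+\infty$; it is known that such fronts are monotonically decreasing in $s$. Neumann conditions: $T_y=0$ at $y=0,H$; periodic conditions: $T(x,y+H,t)=T(x,y,t)$. It is not required that $\bigcup_jI_j=[0,H]$.
   Formalization: The intervals I_j are required to be pairwise disjoint; for arbitrary overlapping collections the inequality fails, e.g. for infinitely many nested intervals of comparable length on which u is nearly constant and nonzero, where the sum diverges while c is finite. *)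

theory Defs
  imports "HOL-Analysis.Analysis"
begin

text \<open>Continuous differentiability relative to \<open>S\<close>: at the end points of a compact interval the
  derivative is one-sided.\<close>

definition C1_on :: "real set \<Rightarrow> (real \<Rightarrow> real) \<Rightarrow> bool" where
  "C1_on S g \<longleftrightarrow>
     (\<exists>g'. (\<forall>x\<in>S. (g has_real_derivative g' x) (at x within S)) \<and> continuous_on S g')"

definition reaction :: "(real \<Rightarrow> real) \<Rightarrow> bool" where
  "reaction f \<longleftrightarrow>
     C1_on {0..1} f \<and> f 0 = 0 \<and> f 1 = 0 \<and> (\<forall>z\<in>{0<..<1}. f z \<ge> 0) \<and> (\<exists>z\<in>{0..1}. f z \<noteq> 0)"

definition general_KPP :: "(real \<Rightarrow> real) \<Rightarrow> bool" where
  "general_KPP f \<longleftrightarrow> reaction f \<and> (\<forall>z\<in>{0<..<1}. f z > 0)"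

definition ignition :: "(real \<Rightarrow> real) \<Rightarrow> bool" where
  "ignition f \<longleftrightarrow>
     reaction f \<and>
     (\<exists>\<theta>\<^sub>0\<in>{0<..<1}. (\<forall>z\<in>{0..\<theta>\<^sub>0}. f z = 0) \<and> f 1 = 0 \<and> (\<forall>z\<in>{\<theta>\<^sub>0<..<1}. f z > 0))"

text \<open>Classical solutions \<open>T x y t\<close> of
  \<open>T\<^sub>t + u(y) T\<^sub>x = \<kappa> \<Delta>T + (v\<^sub>0\<^sup>2 / \<kappa>) f(T)\<close> on the closed strip \<open>\<real> \<times> [0,H]\<close>, for all
  times. The derivatives in the equation exist and are jointly continuous up to the boundary; those in
  \<open>y\<close> are one-sided at \<open>y = 0\<close> and \<open>y = H\<close>.\<close>

definition strip_solution ::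
  "real \<Rightarrow> real \<Rightarrow> real \<Rightarrow> (real \<Rightarrow> real) \<Rightarrow> (real \<Rightarrow> real) \<Rightarrow> (real \<Rightarrow> real \<Rightarrow> real \<Rightarrow> real) \<Rightarrow> bool"
where
  "strip_solution \<kappa> v\<^sub>0 H u f T \<longleftrightarrow>
     (\<exists>Tt Tx Ty Txx Tyy.
        (\<forall>x t. \<forall>y\<in>{0..H}.
           ((\<lambda>t. T x y t) has_real_derivative Tt x y t) (at t) \<and>
           ((\<lambda>x. T x y t) has_real_derivative Tx x y t) (at x) \<and>
           ((\<lambda>x. Tx x y t) has_real_derivative Txx x y t) (at x) \<and>
           ((\<lambda>y. T x y t) has_real_derivative Ty x y t) (at y within {0..H}) \<and>
           ((\<lambda>y. Ty x y t) has_real_derivative Tyy x y t) (at y within {0..H}) \<and>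
           Tt x y t + u y * Tx x y t =
             \<kappa> * (Txx x y t + Tyy x y t) + v\<^sub>0\<^sup>2 / \<kappa> * f (T x y t)) \<and>
        (\<forall>F\<in>{T, Tt, Tx, Ty, Txx, Tyy}.
           continuous_on (UNIV \<times> {0..H} \<times> UNIV) (\<lambda>(x, y, t). F x y t)))"

definition neumann_bc :: "real \<Rightarrow> (real \<Rightarrow> real \<Rightarrow> real \<Rightarrow> real) \<Rightarrow> bool" where
  "neumann_bc H T \<longleftrightarrow>
     (\<forall>x t. \<forall>y\<in>{0, H}. ((\<lambda>y. T x y t) has_real_derivative 0) (at y within {0..H}))"

text \<open>Two-sided differentiability in \<open>y\<close> is needed because \<open>strip_solution\<close> only sees
  \<open>0 \<le> y \<le> H\<close>: it rules out a kink of the periodic extension at \<open>y = 0\<close> and gives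
  \<open>T\<^sub>y(x,0,t) = T\<^sub>y(x,H,t)\<close>.\<close>

definition periodic_bc :: "real \<Rightarrow> (real \<Rightarrow> real \<Rightarrow> real \<Rightarrow> real) \<Rightarrow> bool" where
  "periodic_bc H T \<longleftrightarrow>
     (\<forall>x y t. T x (y + H) t = T x y t \<and> (\<lambda>y. T x y t) differentiable (at y))"

text \<open>\<open>U s y\<close> is the profile and \<open>c\<close> the speed. The limits are pointwise in \<open>y\<close>.\<close>

definition traveling_front ::
  "real \<Rightarrow> real \<Rightarrow> real \<Rightarrow> (real \<Rightarrow> real) \<Rightarrow> (real \<Rightarrow> real) \<Rightarrow> real \<Rightarrow> (real \<Rightarrow> real \<Rightarrow> real) \<Rightarrow> bool"
where
  "traveling_front \<kappa> v\<^sub>0 H u f c U \<longleftrightarrow>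
     (let T = (\<lambda>x y t. U (x - c * t) y) in
        strip_solution \<kappa> v\<^sub>0 H u f T \<and> (neumann_bc H T \<or> periodic_bc H T)) \<and>
     (\<forall>y\<in>{0..H}.
        (\<forall>s. U s y \<in> {0..1}) \<and>
        ((\<lambda>s. U s y) \<longlongrightarrow> 1) at_bot \<and> ((\<lambda>s. U s y) \<longlongrightarrow> 0) at_top)"

text \<open>The intervals \<open>I\<^sub>j\<close> have centres \<open>m j\<close> and half-widths \<open>h j\<close> for \<open>j \<in> J\<close>. They are pairwise
  disjoint (otherwise one interval could be counted arbitrarily often), hence countable in number,
  so \<open>J \<subseteq> \<nat>\<close> is no restriction; \<open>J\<close> may be finite or infinite.\<close>

definition admissible_intervals ::
  "real \<Rightarrow> (real \<Rightarrow> real) \<Rightarrow> nat set \<Rightarrow> (nat \<Rightarrow> real) \<Rightarrow> (nat \<Rightarrow> real) \<Rightarrow> bool"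
where
  "admissible_intervals H u J m h \<longleftrightarrow>
     (let I = (\<lambda>j. {m j - h j<..<m j + h j}); N = (\<lambda>j. SUP y\<in>I j. \<bar>u y\<bar>) in
        disjoint_family_on I J \<and>
        (\<forall>j\<in>J. h j > 0 \<and> I j \<subseteq> {0..H} \<and> (\<forall>y\<in>I j. N j / 2 \<le> \<bar>u y\<bar> \<and> \<bar>u y\<bar> \<le> N j)))"

end

theory Submission
  imports Defs
begin

text \<open>Integrating the profile equation \<open>(u - c) U\<^sub>s = \<kappa> \<Delta>U + (v\<^sub>0\<^sup>2 / \<kappa>) f(U)\<close> against \<open>2 - U\<close> bounds the
  total of \<open>E = \<kappa> \<bar>\<nabla>U\<bar>\<^sup>2 + (v\<^sub>0\<^sup>2 / \<kappa>) f(U)\<close> over the strip by \<open>3 c H / 2\<close>. Now let \<open>g \<ge> 0\<close> be a cutoff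
  supported where \<open>f\<close> is bounded below, so that \<open>g(U)\<^sup>2\<close> is dominated by \<open>f(U)\<close>, and let \<open>G' = g\<close>. Since
  \<open>U\<close> passes from 1 to 0 on every line, the integral of \<open>g(U) U\<^sub>s\<close> over the strip is \<open>(G 0 - G 1) H\<close>, and
  AM-GM bounds \<open>v\<^sub>0 \<bar>g(U) U\<^sub>s\<bar>\<close> by a multiple of \<open>E\<close>: this gives \<open>c \<ge> C v\<^sub>0\<close>. Testing the equation with
  \<open>\<psi>(y) g(U)\<close> expresses \<open>(G 1 - G 0) \<integral>(c - u) \<psi>\<close> through terms that are all dominated by \<open>E\<close>, provided
  \<open>\<bar>\<psi>\<bar> \<le> 1\<close> and \<open>\<bar>\<psi>'\<bar>\<close> is at most of order \<open>1 / l\<close>; a \<open>\<psi>\<close> made of weighted bumps on the \<open>I\<^sub>j\<close>, with the sign of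
  \<open>u\<close>, gives the sum over the intervals.\<close>

subsection \<open>Bumps\<close>

text \<open>The outer square makes the truncated parabola continuously differentiable at
  \<open>x = 1\<close> and \<open>x = - 1\<close>. The same profile serves as a test function in
  \<open>y\<close> and as the cutoff \<open>g\<close> in the temperature variable.\<close>

definition bump :: "real \<Rightarrow> real" where
  "bump x = (max 0 (1 - x\<^sup>2))\<^sup>2"

definition bump' :: "real \<Rightarrow> real" where
  "bump' x = - 4 * x * max 0 (1 - x\<^sup>2)"

lemma has_real_derivative_max_0_sqr: "((\<lambda>t::real. (max 0 t)\<^sup>2) has_real_derivative 2 * max 0 t) (at t)"
proof -
  consider "t < 0" | "t > 0" | "t = 0" by linarith
  then show ?thesis
  proof cases
    case 1
    have "((\<lambda>_. 0) has_real_derivative 2 * max 0 t) (at t)"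
      using 1 by (auto intro!: derivative_eq_intros)
    then show ?thesis
      by (rule has_field_derivative_transform_within_open[where S = "{..<0}"]) (use 1 in auto)
  next
    case 2
    have "((\<lambda>t. t\<^sup>2) has_real_derivative 2 * max 0 t) (at t)"
      using 2 by (auto intro!: derivative_eq_intros)
    then show ?thesis
      by (rule has_field_derivative_transform_within_open[where S = "{0<..}"]) (use 2 in auto)
  next
    case 3
    have "((\<lambda>h::real. (max 0 h)\<^sup>2 / h) \<longlongrightarrow> 0) (at 0)"
    proof (rule Lim_null_comparison[where g = "\<lambda>h. \<bar>h\<bar>"])
      have "norm ((max 0 h)\<^sup>2 / h) \<le> \<bar>h\<bar>" for h :: real
        by (cases "h > 0") (simp_all add: max_def power2_eq_square)
      then show "\<forall>\<^sub>F h::real in at 0. norm ((max 0 h)\<^sup>2 / h) \<le> \<bar>h\<bar>"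
        by (intro always_eventually allI)
      show "((\<lambda>h::real. \<bar>h\<bar>) \<longlongrightarrow> 0) (at 0)"
        by (rule tendsto_rabs_zero[OF tendsto_ident_at])
    qed
    then show ?thesis
      using 3 by (simp add: DERIV_def)
  qed
qed

lemma bump_has_real_derivative: "(bump has_real_derivative bump' x) (at x)"
proof -
  have "((\<lambda>x::real. 1 - x\<^sup>2) has_real_derivative - 2 * x) (at x)"
    by (auto intro!: derivative_eq_intros)
  from DERIV_chain2[OF has_real_derivative_max_0_sqr this] show ?thesis
    by (simp add: bump_def[abs_def] bump'_def mult_ac)
qed

lemma continuous_on_bump [continuous_intros]:
  assumes "continuous_on S p"
  shows "continuous_on S (\<lambda>x. bump (p x))"
  unfolding bump_def by (intro continuous_intros assms)

lemma continuous_on_bump' [continuous_intros]: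
  assumes "continuous_on S p"
  shows "continuous_on S (\<lambda>x. bump' (p x))"
  unfolding bump'_def by (intro continuous_intros assms)

lemma bump_nonneg: "0 \<le> bump x"
  by (simp add: bump_def)

lemma bump_le_1: "bump x \<le> 1"
  unfolding bump_def by (rule power_le_one) auto

lemma bump_outside: "1 \<le> \<bar>x\<bar> \<Longrightarrow> bump x = 0"
  by (simp add: bump_def abs_le_square_iff[of 1 x, simplified])

lemma bump'_outside: "1 \<le> \<bar>x\<bar> \<Longrightarrow> bump' x = 0"
  by (simp add: bump'_def abs_le_square_iff[of 1 x, simplified])

lemma bump_pos: "\<bar>x\<bar> < 1 \<Longrightarrow> 0 < bump x"
  using abs_square_less_1[of x] by (simp add: bump_def)

lemma abs_bump'_le: "\<bar>bump' x\<bar> \<le> 4"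
proof (cases "\<bar>x\<bar> < 1")
  case True
  have "\<bar>x\<bar> * max 0 (1 - x\<^sup>2) \<le> 1 * 1"
    using True by (intro mult_mono) auto
  then show ?thesis
    by (simp add: bump'_def abs_mult)
qed (simp add: bump'_outside)

lemma bump_ge_half:
  assumes "\<bar>x\<bar> \<le> 1 / 2"
  shows "1 / 2 \<le> bump x"
proof -
  have "\<bar>x\<bar>\<^sup>2 \<le> (1 / 2)\<^sup>2"
    using assms by (intro power_mono) auto
  \<comment> \<open>The square of \<open>3 / 4\<close> is \<open>9 / 16\<close>, just above the
    claimed \<open>1 / 2\<close>.\<close>
  then have "(3 / 4)\<^sup>2 \<le> (max 0 (1 - x\<^sup>2))\<^sup>2"
    by (intro power_mono) (auto simp: power2_eq_square)
  then show ?thesis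
    by (simp add: bump_def power2_eq_square)
qed

lemma bump_scaled_has_real_derivative:
  "((\<lambda>y. bump ((y - m) / h)) has_real_derivative bump' ((y - m) / h) / h) (at y)"
proof -
  have "((\<lambda>y. (y - m) / h) has_real_derivative 1 / h) (at y)"
    by (intro DERIV_cdivide) (auto intro!: derivative_eq_intros)
  from DERIV_chain2[OF bump_has_real_derivative this] show ?thesis
    by simp
qed

section \<open>Calculus on intervals and sums over disjoint intervals\<close>

lemma continuous_has_primitive:
  fixes g :: "real \<Rightarrow> real"
  assumes "continuous_on UNIV g"
  obtains G where "\<forall>z. (G has_real_derivative g z) (at z)"
proof -
  have "isCont g z" for z
    using assms by (simp add: continuous_on_eq_continuous_at)
  then have "\<exists>G. \<forall>z::real. - \<infinity> < ereal z \<longrightarrow> ereal z < \<infinity> \<longrightarrow> (G has_vector_derivative g z) (at z)"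
    by (intro einterval_antiderivative) auto
  then show ?thesis
    using that by (auto simp: has_real_derivative_iff_has_vector_derivative)
qed

text \<open>Serves to read off \<open>Uy\<close> at \<open>y = 0\<close> and \<open>y = H\<close>,
  where its defining derivative is one-sided, from the boundary conditions.\<close>

lemma has_real_derivative_unique_Icc:
  fixes g :: "real \<Rightarrow> real"
  assumes "a < b" "x \<in> {a..b}"
    and "(g has_real_derivative D) (at x within {a..b})"
    and "(g has_real_derivative E) (at x within {a..b})"
  shows "D = E"
  using vector_derivative_unique_within_closed_interval[of a b x g D E] assms
  by (auto simp: has_real_derivative_iff_has_vector_derivative)

lemma integral_mean_value:
  fixes k :: "real \<Rightarrow> real"
  assumes "a < b" and k: "continuous_on {a..b} k"
  obtains x where "x \<in> {a..b}" "integral {a..b} k = (b - a) * k x"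
proof -
  have "\<exists>x\<in>{a<..<b}. integral {a..b} k - integral {a..a} k = (\<lambda>t. k x * t) (b - a)"
  proof (rule mvt_simple[OF \<open>a < b\<close>])
    fix x assume "a \<le> x" "x \<le> b"
    then show "((\<lambda>x. integral {a..x} k) has_derivative (\<lambda>t. k x * t)) (at x within {a..b})"
      using integral_has_real_derivative[OF k, of x] by (auto simp: has_field_derivative_def)
  qed
  then obtain x where "x \<in> {a<..<b}" "integral {a..b} k = k x * (b - a)"
    by auto
  then show ?thesis
    using that[of x] by (auto simp: mult.commute)
qed

text \<open>A point \<open>y\<close> lies in at most one \<open>I j\<close>, so at most one summand
  survives. The bound therefore does not grow with the number of intervals, which later allows
  infinite families.\<close>

lemma abs_sum_disjoint_le:
  fixes a :: "'i \<Rightarrow> real"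
  assumes "finite J" and disj: "disjoint_family_on I J"
    and out: "\<And>j. j \<in> J \<Longrightarrow> y \<notin> I j \<Longrightarrow> a j = 0"
    and le: "\<And>j. j \<in> J \<Longrightarrow> \<bar>a j\<bar> \<le> B" and "0 \<le> B"
  shows "\<bar>\<Sum>j\<in>J. a j\<bar> \<le> B"
proof (cases "\<exists>i\<in>J. y \<in> I i")
  case True
  then obtain i where i: "i \<in> J" "y \<in> I i" by blast
  have "a j = 0" if "j \<in> J - {i}" for j
    using disjoint_family_onD[OF disj, of i j] i that by (intro out) auto
  then have "(\<Sum>j\<in>J. a j) = (\<Sum>j\<in>{i}. a j)"
    by (intro sum.mono_neutral_right) (use \<open>finite J\<close> i in auto)
  then show ?thesis
    using le[OF i(1)] by simp
next
  case False
  then have "(\<Sum>j\<in>J. a j) = 0"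
    by (intro sum.neutral) (auto intro: out)
  then show ?thesis
    using \<open>0 \<le> B\<close> by simp
qed

lemma scaled_outside:
  fixes y m h :: real
  assumes "h > 0" "y \<notin> {m - h<..<m + h}"
  shows "1 \<le> \<bar>(y - m) / h\<bar>"
  using assms by (auto simp: abs_divide le_divide_eq)

lemma sgn_mult_eq_abs:
  fixes u :: "real \<Rightarrow> real"
  assumes u: "continuous_on I u" and I: "connected I" "x \<in> I" "y \<in> I"
    and N: "\<And>z. z \<in> I \<Longrightarrow> N / 2 \<le> \<bar>u z\<bar> \<and> \<bar>u z\<bar> \<le> N"
  shows "u y * sgn (u x) = \<bar>u y\<bar>"
proof (cases "0 \<in> u ` I")
  case True
  then obtain z where "z \<in> I" "u z = 0" by auto
  then have "N \<le> 0"
    using N[of z] by simp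
  then have "u y = 0"
    using N[OF I(3)] by linarith
  then show ?thesis
    by simp
next
  case False
  have conn: "connected (u ` I)"
    using I(1) u by (rule connected_continuous_image[rotated])
  have "u x > 0 \<longleftrightarrow> u y > 0"
  proof (rule ccontr)
    assume "\<not> (u x > 0 \<longleftrightarrow> u y > 0)"
    then have "u x \<le> 0 \<and> 0 \<le> u y \<or> u y \<le> 0 \<and> 0 \<le> u x"
      by linarith
    then have "0 \<in> u ` I"
      using connectedD_interval[OF conn, of "u x" "u y" 0] connectedD_interval[OF conn, of "u y" "u x" 0] I
      by blast
    with False show False by blast
  qed
  moreover have "u x \<noteq> 0" "u y \<noteq> 0"
    using False I by (metis image_eqI)+
  ultimately show ?thesis
    by (cases "u x > 0") auto
qed

text \<open>The left side is at most \<open>2 * h * N\<close>. On the middle half, of length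
  \<open>h\<close>, both \<open>\<bar>u y\<bar> \<ge> N / 2\<close> and
  \<open>bump \<ge> 1 / 2\<close> hold, so the right integral is at least \<open>h * N / 4\<close>;
  the ratio is the factor 8. The sign at the centre turns \<open>u\<close> into its absolute
  value.\<close>

lemma integral_abs_le_bump:
  fixes u :: "real \<Rightarrow> real"
  assumes u: "continuous_on {0..H} u" and h: "h > 0" and sub: "{m - h<..<m + h} \<subseteq> {0..H}"
    and N: "\<And>y. y \<in> {m - h<..<m + h} \<Longrightarrow> N / 2 \<le> \<bar>u y\<bar> \<and> \<bar>u y\<bar> \<le> N"
  shows "integral {m - h..m + h} (\<lambda>y. \<bar>u y\<bar>) \<le>
    8 * integral {0..H} (\<lambda>y. u y * (sgn (u m) * bump ((y - m) / h)))"
proof -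
  let ?b = "\<lambda>y. bump ((y - m) / h)"
  have bounds: "0 \<le> m - h" "m + h \<le> H"
    using sub h by (auto simp: greaterThanLessThan_subseteq_atLeastAtMost_iff)
  have cont: "continuous_on S u" if "S \<subseteq> {0..H}" for S
    using u that by (rule continuous_on_subset)
  have cu: "continuous_on {m - h..m + h} (\<lambda>y. \<bar>u y\<bar>)"
    by (intro continuous_intros cont) (use bounds in auto)
  \<comment> \<open>The bound is given on the open interval only; continuity carries it to the end
    points of the domain of integration.\<close>
  have "\<bar>u y\<bar> \<le> N" if "y \<in> {m - h..m + h}" for y
  proof (rule continuous_le_on_closure[where f = "\<lambda>y. \<bar>u y\<bar>" and x = y and S = "{m - h<..<m + h}"])
    show "continuous_on (closure {m - h<..<m + h}) (\<lambda>y. \<bar>u y\<bar>)"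
      using cu h by simp
    show "y \<in> closure {m - h<..<m + h}"
      using that h by simp
  qed (use N in auto)
  then have "integral {m - h..m + h} (\<lambda>y. \<bar>u y\<bar>) \<le> integral {m - h..m + h} (\<lambda>y. N)"
    by (intro integral_le integrable_continuous_real cu) auto
  also have "\<dots> = 8 * integral {m - h / 2..m + h / 2} (\<lambda>y. N / 2 * (1 / 2))"
    using h by simp
  also have "integral {m - h / 2..m + h / 2} (\<lambda>y. N / 2 * (1 / 2)) \<le>
      integral {m - h / 2..m + h / 2} (\<lambda>y. \<bar>u y\<bar> * ?b y)"
  proof (intro integral_le integrable_continuous_real continuous_intros cont)
    fix y assume y: "y \<in> {m - h / 2..m + h / 2}"
    then have "\<bar>y - m\<bar> \<le> h / 2"
      by (subst abs_le_iff) auto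
    then have "\<bar>(y - m) / h\<bar> \<le> 1 / 2"
      using h by (simp add: abs_divide divide_le_eq)
    then have "1 / 2 \<le> ?b y"
      by (rule bump_ge_half)
    moreover have "N / 2 \<le> \<bar>u y\<bar>"
      using N[of y] y h by auto
    ultimately show "N / 2 * (1 / 2) \<le> \<bar>u y\<bar> * ?b y"
      by (intro mult_mono) auto
  qed (use bounds h in auto)
  also have "\<dots> \<le> integral {0..H} (\<lambda>y. \<bar>u y\<bar> * ?b y)"
    by (intro integral_subset_le integrable_continuous_real continuous_intros cont)
       (use bounds h in \<open>auto simp: bump_nonneg\<close>)
  also have "\<dots> = integral {0..H} (\<lambda>y. u y * (sgn (u m) * ?b y))"
  proof (intro integral_cong)
    fix y assume "y \<in> {0..H}"
    show "\<bar>u y\<bar> * ?b y = u y * (sgn (u m) * ?b y)"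
    proof (cases "y \<in> {m - h<..<m + h}")
      case True
      have "u y * sgn (u m) = \<bar>u y\<bar>"
        by (rule sgn_mult_eq_abs[OF cont[OF sub] _ _ True N]) (use h in auto)
      then show ?thesis
        by (simp flip: mult.assoc)
    next
      case False
      then show ?thesis
        using bump_outside[OF scaled_outside[OF h False]] by simp
    qed
  qed
  finally show ?thesis by simp
qed

subsection \<open>Front profiles\<close>

text \<open>The front in the moving frame, where the time derivative has become
  \<open>- c * Us\<close>. Neumann and periodic conditions are merged into one disjunction: in
  either case \<open>g (U s y) * Uy s y\<close> takes the same value at \<open>y = 0\<close> and
  \<open>y = H\<close>.\<close>

locale front_profile =
  fixes \<kappa> v\<^sub>0 H c :: real and u f :: "real \<Rightarrow> real" and U Us Uy Uss Uyy :: "real \<Rightarrow> real \<Rightarrow> real"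
  assumes \<kappa>: "\<kappa> > 0" and v\<^sub>0: "v\<^sub>0 > 0" and H: "H > 0"
    and U_s: "y \<in> {0..H} \<Longrightarrow> ((\<lambda>s. U s y) has_real_derivative Us s y) (at s)"
    and U_ss: "y \<in> {0..H} \<Longrightarrow> ((\<lambda>s. Us s y) has_real_derivative Uss s y) (at s)"
    and U_y: "y \<in> {0..H} \<Longrightarrow> (U s has_real_derivative Uy s y) (at y within {0..H})"
    and U_yy: "y \<in> {0..H} \<Longrightarrow> (Uy s has_real_derivative Uyy s y) (at y within {0..H})"
    and profile_eq: "y \<in> {0..H} \<Longrightarrow>
      (u y - c) * Us s y = \<kappa> * (Uss s y + Uyy s y) + v\<^sub>0\<^sup>2 / \<kappa> * f (U s y)"
    and cont_U: "continuous_on (UNIV \<times> {0..H}) (\<lambda>p. U (fst p) (snd p))"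
    and cont_Us: "continuous_on (UNIV \<times> {0..H}) (\<lambda>p. Us (fst p) (snd p))"
    and cont_Uy: "continuous_on (UNIV \<times> {0..H}) (\<lambda>p. Uy (fst p) (snd p))"
    and cont_Uss: "continuous_on (UNIV \<times> {0..H}) (\<lambda>p. Uss (fst p) (snd p))"
    and cont_Uyy: "continuous_on (UNIV \<times> {0..H}) (\<lambda>p. Uyy (fst p) (snd p))"
    and boundary: "Uy s 0 = 0 \<and> Uy s H = 0 \<or> U s 0 = U s H \<and> Uy s 0 = Uy s H"
    and U_range: "y \<in> {0..H} \<Longrightarrow> U s y \<in> {0..1}"
    and U_at_bot: "y \<in> {0..H} \<Longrightarrow> ((\<lambda>s. U s y) \<longlongrightarrow> 1) at_bot"
    and U_at_top: "y \<in> {0..H} \<Longrightarrow> ((\<lambda>s. U s y) \<longlongrightarrow> 0) at_top"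
    and cont_u: "continuous_on {0..H} u"
    and mean_u: "integral {0..H} u = 0"
    and cont_f: "continuous_on {0..1} f"
    and f_nonneg: "z \<in> {0..1} \<Longrightarrow> f z \<ge> 0"
begin

section \<open>Continuity and integration on the strip\<close>

definition strip_continuous :: "(real \<Rightarrow> real \<Rightarrow> real) \<Rightarrow> bool" where
  "strip_continuous F \<longleftrightarrow> continuous_on (UNIV \<times> {0..H}) (\<lambda>p. F (fst p) (snd p))"

lemma strip_continuous_y:
  assumes "strip_continuous F"
  shows "continuous_on {0..H} (F s)"
proof -
  have "continuous_on {0..H} (\<lambda>y. (\<lambda>p. F (fst p) (snd p)) (s, y))"
    by (rule continuous_on_compose2[OF assms[unfolded strip_continuous_def]])
       (auto intro!: continuous_intros)
  then show ?thesis by simp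
qed

lemma strip_continuous_integral:
  assumes "strip_continuous F"
  shows "continuous_on S (\<lambda>s. integral {0..H} (F s))"
proof -
  have "continuous_on (S \<times> cbox 0 H) (\<lambda>(s, y). F s y)"
    using assms unfolding strip_continuous_def case_prod_beta
    by (rule continuous_on_subset) auto
  from integral_continuous_on_param[OF this] show ?thesis by simp
qed

lemma strip_continuous_swap:
  assumes "strip_continuous F"
  shows "integral {a..b} (\<lambda>s. integral {0..H} (F s)) = integral {0..H} (\<lambda>y. integral {a..b} (\<lambda>s. F s y))"
proof -
  have "continuous_on (cbox (a, 0) (b, H)) (\<lambda>(s, y). F s y)"
    using assms unfolding strip_continuous_def case_prod_beta
    by (rule continuous_on_subset) auto
  from integral_swap_continuous[OF this] show ?thesis by simp
qed

lemma continuous_on_strip_fun: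
  assumes "continuous_on {0..H} \<phi>"
  shows "continuous_on (UNIV \<times> {0..H}) (\<lambda>p. \<phi> (snd p))"
  by (rule continuous_on_compose2[OF assms]) (auto intro!: continuous_intros)

lemma continuous_on_strip_comp:
  assumes "continuous_on UNIV g"
  shows "continuous_on (UNIV \<times> {0..H}) (\<lambda>p. g (U (fst p) (snd p)))"
  by (rule continuous_on_compose2[OF assms cont_U]) auto

lemma continuous_on_strip_f: "continuous_on (UNIV \<times> {0..H}) (\<lambda>p. f (U (fst p) (snd p)))"
  by (rule continuous_on_compose2[OF cont_f cont_U]) (use U_range in auto)

lemmas strip_intros = continuous_intros cont_U cont_Us cont_Uy cont_Uss cont_Uyy
  continuous_on_strip_fun continuous_on_strip_comp continuous_on_strip_f

text \<open>After exchanging the order of integration, the fundamental theorem of calculus applies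
  on each line of constant \<open>y\<close>.\<close>

lemma strip_derivative_integral:
  assumes F: "\<And>s y. y \<in> {0..H} \<Longrightarrow> ((\<lambda>s. F s y) has_real_derivative F' s y) (at s)"
    and cF: "strip_continuous F" and cF': "strip_continuous F'" and "a \<le> b"
  shows "integral {a..b} (\<lambda>s. integral {0..H} (F' s)) = integral {0..H} (F b) - integral {0..H} (F a)"
proof -
  have "integral {a..b} (\<lambda>s. F' s y) = F b y - F a y" if "y \<in> {0..H}" for y
    by (intro integral_unique fundamental_theorem_of_calculus \<open>a \<le> b\<close>
          has_field_derivative_at_within[THEN has_real_derivative_iff_has_vector_derivative[THEN iffD1]] F that)
  then have "integral {a..b} (\<lambda>s. integral {0..H} (F' s)) = integral {0..H} (\<lambda>y. F b y - F a y)"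
    unfolding strip_continuous_swap[OF cF'] by (intro integral_cong) auto
  also have "\<dots> = integral {0..H} (F b) - integral {0..H} (F a)"
    by (intro integral_diff integrable_continuous_real strip_continuous_y cF)
  finally show ?thesis .
qed

text \<open>The limits of \<open>U\<close> are known only pointwise in \<open>y\<close>. As
  \<open>U\<close> stays in the compact set \<open>{0..1}\<close>, \<open>G (U s y)\<close> is
  bounded, and dominated convergence passes the limit through the integral.\<close>

lemma weighted_limit:
  fixes \<sigma> :: "nat \<Rightarrow> real"
  assumes lim: "\<And>y. y \<in> {0..H} \<Longrightarrow> (\<lambda>n. U (\<sigma> n) y) \<longlonglongrightarrow> z"
    and \<phi>: "continuous_on {0..H} \<phi>" and G: "continuous_on UNIV (G :: real \<Rightarrow> real)"
  shows "(\<lambda>n. integral {0..H} (\<lambda>y. \<phi> y * G (U (\<sigma> n) y))) \<longlonglongrightarrow> integral {0..H} (\<lambda>y. \<phi> y * G z)"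
proof -
  have "compact (G ` {0..1})"
    by (intro compact_continuous_image continuous_on_subset[OF G]) auto
  then obtain B where B: "\<And>x. x \<in> {0..1} \<Longrightarrow> \<bar>G x\<bar> \<le> B"
    by (force dest!: compact_imp_bounded simp: bounded_iff)
  have sc: "strip_continuous (\<lambda>s y. \<phi> y * G (U s y))"
    unfolding strip_continuous_def by (intro strip_intros \<phi> G)
  show ?thesis
  proof (rule dominated_convergence(2)[where h = "\<lambda>y. \<bar>\<phi> y\<bar> * B"])
    show "(\<lambda>y. \<phi> y * G (U (\<sigma> n) y)) integrable_on {0..H}" for n
      by (rule integrable_continuous_real[OF strip_continuous_y[OF sc]])
    show "(\<lambda>y. \<bar>\<phi> y\<bar> * B) integrable_on {0..H}"
      by (intro integrable_continuous_real continuous_intros \<phi>)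
    show "norm (\<phi> y * G (U (\<sigma> n) y)) \<le> \<bar>\<phi> y\<bar> * B" if "y \<in> {0..H}" for n y
      using B[OF U_range[OF that]] by (simp add: abs_mult mult_left_mono)
    show "(\<lambda>n. \<phi> y * G (U (\<sigma> n) y)) \<longlonglongrightarrow> \<phi> y * G z" if "y \<in> {0..H}" for y
      using G by (intro tendsto_intros isCont_tendsto_compose[OF _ lim[OF that]])
        (simp add: continuous_on_eq_continuous_at)
  qed
qed

text \<open>The derivatives of \<open>U\<close> are not known to decay as \<open>s \<rightarrow> \<plusminus>\<infinity>\<close>, but by the mean value theorem
  every unit window contains a point \<open>s\<close> at which the averaged flux equals the change of the average
  of \<open>\<psi> G(U)\<close> across the window.\<close>

lemma flux_limit:
  fixes \<tau> :: "nat \<Rightarrow> real"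
  assumes limU: "\<And>y. y \<in> {0..H} \<Longrightarrow> ((\<lambda>s. U s y) \<longlongrightarrow> z) F"
    and \<tau>: "\<And>\<sigma>. \<forall>n. \<sigma> n \<in> {\<tau> n..\<tau> n + 1} \<Longrightarrow> filterlim \<sigma> F sequentially"
    and \<psi>: "continuous_on {0..H} \<psi>"
    and G: "\<And>z. (G has_real_derivative g z) (at z)" and g: "continuous_on UNIV g"
  obtains \<sigma> where "\<forall>n. \<sigma> n \<in> {\<tau> n..\<tau> n + 1}"
    "(\<lambda>n. integral {0..H} (\<lambda>y. (u y - c) * \<psi> y * G (U (\<sigma> n) y) - \<kappa> * \<psi> y * g (U (\<sigma> n) y) * Us (\<sigma> n) y))
       \<longlonglongrightarrow> G z * integral {0..H} (\<lambda>y. (u y - c) * \<psi> y)"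
proof -
  have cG: "continuous_on UNIV G"
    by (rule DERIV_continuous_on, rule G)
  have lim: "(\<lambda>n. U (\<sigma> n) y) \<longlonglongrightarrow> z"
    if "\<And>n. \<sigma> n \<in> {\<tau> n..\<tau> n + 1}" "y \<in> {0..H}" for \<sigma> y
    using filterlim_compose[OF limU \<tau>] that by blast
  define k where "k s = integral {0..H} (\<lambda>y. \<psi> y * g (U s y) * Us s y)" for s
  have sc: "strip_continuous (\<lambda>s y. \<psi> y * g (U s y) * Us s y)" "strip_continuous (\<lambda>s y. \<psi> y * G (U s y))"
    "strip_continuous (\<lambda>s y. (u y - c) * \<psi> y * G (U s y))"
    unfolding strip_continuous_def by (intro strip_intros \<psi> g cG cont_u)+
  have "\<exists>x\<in>{\<tau> n..\<tau> n + 1}. k x = integral {0..H} (\<lambda>y. \<psi> y * G (U (\<tau> n + 1) y)) -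
      integral {0..H} (\<lambda>y. \<psi> y * G (U (\<tau> n) y))" for n
  proof -
    have "continuous_on {\<tau> n..\<tau> n + 1} k"
      unfolding k_def by (rule strip_continuous_integral[OF sc(1)])
    then obtain x where x: "x \<in> {\<tau> n..\<tau> n + 1}" "integral {\<tau> n..\<tau> n + 1} k = (\<tau> n + 1 - \<tau> n) * k x"
      by (rule integral_mean_value[rotated]) auto
    have "integral {\<tau> n..\<tau> n + 1} k = integral {0..H} (\<lambda>y. \<psi> y * G (U (\<tau> n + 1) y)) -
      integral {0..H} (\<lambda>y. \<psi> y * G (U (\<tau> n) y))"
      unfolding k_def
    proof (rule strip_derivative_integral[OF _ sc(2,1)])
      show "((\<lambda>s. \<psi> y * G (U s y)) has_real_derivative \<psi> y * g (U s y) * Us s y) (at s)"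
        if "y \<in> {0..H}" for s y
        by (rule derivative_eq_intros DERIV_chain2[OF G U_s[OF that]] refl)+ simp
    qed auto
    with x show ?thesis by auto
  qed
  then obtain \<sigma> where \<sigma>: "\<forall>n. \<sigma> n \<in> {\<tau> n..\<tau> n + 1}" and
    k: "\<And>n. k (\<sigma> n) = integral {0..H} (\<lambda>y. \<psi> y * G (U (\<tau> n + 1) y)) - integral {0..H} (\<lambda>y. \<psi> y * G (U (\<tau> n) y))"
    by metis
  \<comment> \<open>Both ends of the window approach the same end of the strip, so the increment
    across it, and with it the derivative term, tends to 0.\<close>
  have "(\<lambda>n. k (\<sigma> n)) \<longlonglongrightarrow>
     integral {0..H} (\<lambda>y. \<psi> y * G z) - integral {0..H} (\<lambda>y. \<psi> y * G z)"
    unfolding k by (intro tendsto_diff weighted_limit \<psi> cG lim) auto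
  moreover have "(\<lambda>n. integral {0..H} (\<lambda>y. (u y - c) * \<psi> y * G (U (\<sigma> n) y))) \<longlonglongrightarrow>
     integral {0..H} (\<lambda>y. (u y - c) * \<psi> y * G z)"
    by (intro weighted_limit \<psi> cG lim \<sigma>[rule_format] continuous_intros cont_u) auto
  ultimately have "(\<lambda>n. integral {0..H} (\<lambda>y. (u y - c) * \<psi> y * G (U (\<sigma> n) y)) - \<kappa> * k (\<sigma> n)) \<longlonglongrightarrow>
     integral {0..H} (\<lambda>y. (u y - c) * \<psi> y * G z) - \<kappa> * 0"
    by (intro tendsto_intros) auto
  moreover have "integral {0..H} (\<lambda>y. (u y - c) * \<psi> y * G (U s y)) - \<kappa> * k s =
     integral {0..H} (\<lambda>y. (u y - c) * \<psi> y * G (U s y) - \<kappa> * \<psi> y * g (U s y) * Us s y)" for s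
  proof -
    have "integral {0..H} (\<lambda>y. (u y - c) * \<psi> y * G (U s y) - \<kappa> * (\<psi> y * g (U s y) * Us s y)) =
        integral {0..H} (\<lambda>y. (u y - c) * \<psi> y * G (U s y)) -
        integral {0..H} (\<lambda>y. \<kappa> * (\<psi> y * g (U s y) * Us s y))"
      by (intro integral_diff integrable_continuous_real continuous_on_mult_left
            strip_continuous_y[OF sc(1)] strip_continuous_y[OF sc(3)])
    then show ?thesis
      by (simp add: k_def mult.assoc)
  qed
  moreover have "integral {0..H} (\<lambda>y. (u y - c) * \<psi> y * G z) - \<kappa> * 0 =
      G z * integral {0..H} (\<lambda>y. (u y - c) * \<psi> y)"
    by simp
  ultimately have "(\<lambda>n. integral {0..H} (\<lambda>y. (u y - c) * \<psi> y * G (U (\<sigma> n) y) - \<kappa> * \<psi> y * g (U (\<sigma> n) y) * Us (\<sigma> n) y))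
       \<longlonglongrightarrow> G z * integral {0..H} (\<lambda>y. (u y - c) * \<psi> y)"
    by (simp add: mult.commute[of "G z"])
  with \<sigma> show ?thesis
    by (rule that)
qed

text \<open>What remains of the profile equation after multiplication by \<open>\<psi>(y) g(U)\<close>, once the exact
  derivatives in \<open>s\<close> and \<open>y\<close> are split off.\<close>

definition residual :: "(real \<Rightarrow> real) \<Rightarrow> (real \<Rightarrow> real) \<Rightarrow> (real \<Rightarrow> real) \<Rightarrow> (real \<Rightarrow> real) \<Rightarrow> real \<Rightarrow> real \<Rightarrow> real" where
  "residual \<psi> \<psi>' g g' s y =
     v\<^sub>0\<^sup>2 / \<kappa> * (\<psi> y * g (U s y) * f (U s y))
     - \<kappa> * (\<psi> y * g' (U s y) * ((Us s y)\<^sup>2 + (Uy s y)\<^sup>2))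
     - \<kappa> * (\<psi>' y * g (U s y) * Uy s y)"

definition energy :: "real \<Rightarrow> real \<Rightarrow> real" where
  "energy s y = \<kappa> * ((Us s y)\<^sup>2 + (Uy s y)\<^sup>2) + v\<^sub>0\<^sup>2 / \<kappa> * f (U s y)"

lemma energy_nonneg: "y \<in> {0..H} \<Longrightarrow> 0 \<le> energy s y"
  using \<kappa> f_nonneg[OF U_range[of y s]] by (simp add: energy_def)

lemma strip_continuous_energy: "strip_continuous energy"
  unfolding strip_continuous_def energy_def by (intro strip_intros) (use \<kappa> in auto)

text \<open>The profile equation times \<open>\<psi> y * g (U s y)\<close> reads
  \<open>w' = \<kappa> * d + residual\<close>, where \<open>w'\<close> is the
  \<open>s\<close>-derivative of the flux \<open>w\<close> and \<open>d\<close> is the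
  \<open>y\<close>-derivative of \<open>\<psi> y * g (U s y) * Uy s y\<close>. The \<open>d\<close>
  part integrates to 0 over \<open>{0..H}\<close>, so the residual over a window equals the
  difference of the fluxes at its ends. The window ends are the points that
  \<open>flux_limit\<close> selects.\<close>

lemma weak_identity:
  assumes \<psi>: "\<And>y. y \<in> {0..H} \<Longrightarrow> (\<psi> has_real_derivative \<psi>' y) (at y within {0..H})"
    and \<psi>': "continuous_on {0..H} \<psi>'" and \<psi>_boundary: "\<psi> 0 = \<psi> H"
    and G: "\<And>z. (G has_real_derivative g z) (at z)"
    and g: "\<And>z. (g has_real_derivative g' z) (at z)" and g': "continuous_on UNIV g'"
  obtains a b where "\<forall>n. a n \<le> - real n" "\<forall>n. real n \<le> b n"
    "(\<lambda>n. integral {a n..b n} (\<lambda>s. integral {0..H} (residual \<psi> \<psi>' g g' s)))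
       \<longlonglongrightarrow> (G 1 - G 0) * integral {0..H} (\<lambda>y. (c - u y) * \<psi> y)"
proof -
  have c\<psi>: "continuous_on {0..H} \<psi>"
    using \<psi> by (rule DERIV_continuous_on)
  have cG: "continuous_on UNIV G" and cg: "continuous_on UNIV g"
    by (meson DERIV_continuous_on G g has_field_derivative_at_within)+
  define w where "w = (\<lambda>s y. (u y - c) * \<psi> y * G (U s y) - \<kappa> * \<psi> y * g (U s y) * Us s y)"
  define w' where "w' = (\<lambda>s y. (u y - c) * \<psi> y * (g (U s y) * Us s y)
      - \<kappa> * \<psi> y * (g' (U s y) * Us s y * Us s y + g (U s y) * Uss s y))"
  define d where "d = (\<lambda>s y. \<psi>' y * (g (U s y) * Uy s y)
      + \<psi> y * (g' (U s y) * Uy s y * Uy s y + g (U s y) * Uyy s y))"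
  have sc: "strip_continuous w" "strip_continuous w'" "strip_continuous d"
      "strip_continuous (residual \<psi> \<psi>' g g')"
    unfolding strip_continuous_def w_def w'_def d_def residual_def
    by (intro strip_intros c\<psi> \<psi>' cG cg g' cont_u; use \<kappa> in simp)+
  have w'_eq: "w' s y = \<kappa> * d s y + residual \<psi> \<psi>' g g' s y" if y: "y \<in> {0..H}" for s y
  proof -
    have "(u y - c) * \<psi> y * (g (U s y) * Us s y) =
        \<psi> y * g (U s y) * (\<kappa> * (Uss s y + Uyy s y) + v\<^sub>0\<^sup>2 / \<kappa> * f (U s y))"
      unfolding profile_eq[OF y, symmetric] by (simp add: mult_ac)
    then show ?thesis
      unfolding w'_def d_def residual_def by (simp add: algebra_simps power2_eq_square)
  qed
  have d_int: "integral {0..H} (d s) = 0" for s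
  proof -
    have "(d s has_integral \<psi> H * (g (U s H) * Uy s H) - \<psi> 0 * (g (U s 0) * Uy s 0)) {0..H}"
    proof (rule fundamental_theorem_of_calculus)
      fix y assume y: "y \<in> {0..H}"
      have "((\<lambda>y. \<psi> y * (g (U s y) * Uy s y)) has_real_derivative d s y) (at y within {0..H})"
        unfolding d_def
        by (rule derivative_eq_intros \<psi>[OF y] DERIV_chain'[OF U_y[OF y] g] U_yy[OF y] refl)+
           (simp add: algebra_simps)
      then show "((\<lambda>y. \<psi> y * (g (U s y) * Uy s y)) has_vector_derivative d s y) (at y within {0..H})"
        by (simp add: has_real_derivative_iff_has_vector_derivative)
    qed (use H in simp)
    \<comment> \<open>Under Neumann conditions both terms vanish; under periodic conditions they
      cancel because \<open>\<psi> 0 = \<psi> H\<close>.\<close>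
    moreover have "\<psi> H * (g (U s H) * Uy s H) - \<psi> 0 * (g (U s 0) * Uy s 0) = 0"
      using boundary[of s] \<psi>_boundary by auto
    ultimately show ?thesis
      by (simp add: integral_unique)
  qed
  have w'_int: "integral {0..H} (w' s) = integral {0..H} (residual \<psi> \<psi>' g g' s)" for s
  proof -
    have "integral {0..H} (w' s) = integral {0..H} (\<lambda>y. \<kappa> * d s y + residual \<psi> \<psi>' g g' s y)"
      by (intro integral_cong w'_eq)
    also have "\<dots> = integral {0..H} (\<lambda>y. \<kappa> * d s y) + integral {0..H} (residual \<psi> \<psi>' g g' s)"
      by (intro integral_add integrable_continuous_real continuous_on_mult_left
            strip_continuous_y[OF sc(3)] strip_continuous_y[OF sc(4)])
    finally show ?thesis
      by (simp add: d_int)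
  qed
  have w_deriv: "((\<lambda>s. w s y) has_real_derivative w' s y) (at s)" if y: "y \<in> {0..H}" for s y
    unfolding w_def w'_def
    by (rule derivative_eq_intros DERIV_chain2[OF G U_s[OF y]] DERIV_chain2[OF g U_s[OF y]] U_ss[OF y] refl)+
       (simp add: algebra_simps)
  have flux: "integral {a..b} (\<lambda>s. integral {0..H} (residual \<psi> \<psi>' g g' s)) =
      integral {0..H} (w b) - integral {0..H} (w a)" if "a \<le> b" for a b
    using strip_derivative_integral[OF w_deriv sc(1,2) that] by (simp add: w'_int)
  \<comment> \<open>The unit window is shifted by one so that its right end is
    \<open>- real n\<close>, which gives \<open>a n \<le> - real n\<close>.\<close>
  have bot: "filterlim \<sigma> at_bot sequentially" if "\<forall>n. \<sigma> n \<in> {- real n - 1..(- real n - 1) + 1}" for \<sigma>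
  proof (rule filterlim_at_bot_mono)
    show "filterlim (\<lambda>n. - real n) at_bot sequentially"
      by (simp add: filterlim_uminus_at_bot filterlim_real_sequentially)
  qed (use that in auto)
  obtain a where a: "\<forall>n. a n \<in> {- real n - 1..(- real n - 1) + 1}"
    and a_lim: "(\<lambda>n. integral {0..H} (w (a n))) \<longlonglongrightarrow> G 1 * integral {0..H} (\<lambda>y. (u y - c) * \<psi> y)"
    unfolding w_def by (rule flux_limit[OF U_at_bot bot c\<psi> G cg])
  have top: "filterlim \<sigma> at_top sequentially" if "\<forall>n. \<sigma> n \<in> {real n..real n + 1}" for \<sigma>
    by (rule filterlim_at_top_mono[OF filterlim_real_sequentially]) (use that in auto)
  obtain b where b: "\<forall>n. b n \<in> {real n..real n + 1}"
    and b_lim: "(\<lambda>n. integral {0..H} (w (b n))) \<longlonglongrightarrow> G 0 * integral {0..H} (\<lambda>y. (u y - c) * \<psi> y)"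
    unfolding w_def by (rule flux_limit[OF U_at_top top c\<psi> G cg])
  have ab: "a n \<le> - real n" "real n \<le> b n" for n
    using a[rule_format, of n] b[rule_format, of n] by auto
  have "a n \<le> b n" for n
    using ab[of n] by linarith
  then have "(\<lambda>n. integral {a n..b n} (\<lambda>s. integral {0..H} (residual \<psi> \<psi>' g g' s))) \<longlonglongrightarrow>
      G 0 * integral {0..H} (\<lambda>y. (u y - c) * \<psi> y) - G 1 * integral {0..H} (\<lambda>y. (u y - c) * \<psi> y)"
    by (simp add: flux tendsto_diff[OF b_lim a_lim])
  moreover have "integral {0..H} (\<lambda>y. (u y - c) * \<psi> y) = - integral {0..H} (\<lambda>y. (c - u y) * \<psi> y)"
    by (simp flip: integral_neg add: algebra_simps)
  ultimately show ?thesis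
    using that[of a b] ab by (simp add: algebra_simps)
qed

text \<open>Here the zero mean of the shear enters: with a constant test function only the speed is
  left.\<close>

lemma integral_const_minus_u: "integral {0..H} (\<lambda>y. c - u y) = c * H"
  using H by (subst integral_diff) (auto intro!: integrable_continuous_real cont_u simp: mean_u)

text \<open>Testing with \<open>g(U) = 2 - U\<close>, for which both \<open>g \<ge> 1\<close> and \<open>- g' = 1\<close>, bounds reaction and
  dissipation at once.\<close>

lemma integral_energy_le: "integral {a..b} (\<lambda>s. integral {0..H} (energy s)) \<le> 3 / 2 * c * H"
proof -
  let ?r = "residual (\<lambda>_. 1) (\<lambda>_. 0) (\<lambda>z. 2 - z) (\<lambda>_. - 1)"
  \<comment> \<open>The primitive \<open>2 * z - z\<^sup>2 / 2\<close> of \<open>2 - z\<close> rises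
    by \<open>3 / 2\<close> from 0 to 1, whence the constant in the bound.\<close>
  obtain \<alpha> \<beta> where \<alpha>: "\<forall>n. \<alpha> n \<le> - real n" and \<beta>: "\<forall>n. real n \<le> \<beta> n" and
    lim: "(\<lambda>n. integral {\<alpha> n..\<beta> n} (\<lambda>s. integral {0..H} (?r s))) \<longlonglongrightarrow>
      ((2 * 1 - 1\<^sup>2 / 2) - (2 * 0 - 0\<^sup>2 / 2)) * integral {0..H} (\<lambda>y. (c - u y) * 1)"
    by (rule weak_identity[where \<psi> = "\<lambda>_. 1" and \<psi>' = "\<lambda>_. 0" and G = "\<lambda>z. 2 * z - z\<^sup>2 / 2"
          and g = "\<lambda>z. 2 - z" and g' = "\<lambda>_. - 1"])
       (auto intro!: derivative_eq_intros)
  have sr: "strip_continuous ?r"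
    unfolding strip_continuous_def residual_def
    by (intro strip_intros) (use \<kappa> in auto)
  have le: "energy s y \<le> ?r s y" if y: "y \<in> {0..H}" for s y
  proof -
    have "1 * f (U s y) \<le> (2 - U s y) * f (U s y)"
      using U_range[OF y, of s] f_nonneg[OF U_range[OF y, of s]] by (intro mult_right_mono) auto
    then have "v\<^sub>0\<^sup>2 / \<kappa> * f (U s y) \<le> v\<^sub>0\<^sup>2 / \<kappa> * ((2 - U s y) * f (U s y))"
      using \<kappa> by (intro mult_left_mono) auto
    moreover have "?r s y = v\<^sub>0\<^sup>2 / \<kappa> * ((2 - U s y) * f (U s y)) + \<kappa> * ((Us s y)\<^sup>2 + (Uy s y)\<^sup>2)"
      by (simp add: residual_def algebra_simps)
    ultimately show ?thesis
      unfolding energy_def by linarith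
  qed
  have int_nonneg: "0 \<le> integral {0..H} (energy s)" for s
    by (intro Henstock_Kurzweil_Integration.integral_nonneg integrable_continuous_real
          strip_continuous_y strip_continuous_energy energy_nonneg)
  have int_le: "integral {0..H} (energy s) \<le> integral {0..H} (?r s)" for s
    by (intro integral_le integrable_continuous_real strip_continuous_y sr strip_continuous_energy le)
  \<comment> \<open>For large \<open>n\<close> the given window lies inside
    \<open>{\<alpha> n..\<beta> n}\<close>, and since the energy is nonnegative, enlarging the
    window only increases the integral.\<close>
  have "integral {a..b} (\<lambda>s. integral {0..H} (energy s)) \<le>
      integral {\<alpha> n..\<beta> n} (\<lambda>s. integral {0..H} (?r s))" if n: "n \<ge> nat \<lceil>max \<bar>a\<bar> \<bar>b\<bar>\<rceil>" for n
  proof -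
    have "\<bar>a\<bar> \<le> real n" "\<bar>b\<bar> \<le> real n"
      using n by linarith+
    then have "\<alpha> n \<le> a" "b \<le> \<beta> n"
      using \<alpha>[rule_format, of n] \<beta>[rule_format, of n] by auto
    then have "integral {a..b} (\<lambda>s. integral {0..H} (energy s)) \<le>
        integral {\<alpha> n..\<beta> n} (\<lambda>s. integral {0..H} (energy s))"
      by (intro integral_subset_le integrable_continuous_real strip_continuous_integral
            strip_continuous_energy) (use int_nonneg in auto)
    also have "\<dots> \<le> integral {\<alpha> n..\<beta> n} (\<lambda>s. integral {0..H} (?r s))"
      by (intro integral_le integrable_continuous_real strip_continuous_integral
            strip_continuous_energy sr int_le)
    finally show ?thesis .
  qed
  then have "integral {a..b} (\<lambda>s. integral {0..H} (energy s)) \<le>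
      ((2 * 1 - 1\<^sup>2 / 2) - (2 * 0 - 0\<^sup>2 / 2)) * integral {0..H} (\<lambda>y. (c - u y) * 1)"
    by (intro LIMSEQ_le_const[OF lim]) blast
  then show ?thesis
    by (simp add: integral_const_minus_u)
qed

section \<open>Bounds by the speed for quantities dominated by the energy\<close>

lemma abs_integral_le_speed:
  assumes F: "strip_continuous F" and "C \<ge> 0"
    and le: "\<And>s y. y \<in> {0..H} \<Longrightarrow> \<bar>F s y\<bar> \<le> C * energy s y"
  shows "\<bar>integral {a..b} (\<lambda>s. integral {0..H} (F s))\<bar> \<le> C * (3 / 2 * c * H)"
proof -
  have "norm (integral {0..H} (F s)) \<le> integral {0..H} (\<lambda>y. C * energy s y)" for s
    by (intro integral_norm_bound_integral integrable_continuous_real continuous_on_mult_left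
          strip_continuous_y F strip_continuous_energy) (use le in auto)
  then have "norm (integral {a..b} (\<lambda>s. integral {0..H} (F s))) \<le>
      integral {a..b} (\<lambda>s. C * integral {0..H} (energy s))"
    by (intro integral_norm_bound_integral integrable_continuous_real continuous_on_mult_left
          strip_continuous_integral F strip_continuous_energy) auto
  also have "\<dots> \<le> C * (3 / 2 * c * H)"
    using mult_left_mono[OF integral_energy_le \<open>C \<ge> 0\<close>] by simp
  finally show ?thesis by simp
qed

text \<open>Expand the square of \<open>v\<^sub>0 * \<bar>x\<bar> - \<kappa> * \<bar>p\<bar>\<close>
  and divide by \<open>\<kappa>\<close>. The weights match the two parts of \<open>energy\<close>,
  and their geometric mean is \<open>v\<^sub>0\<close>.\<close>

lemma amgm_flux: "v\<^sub>0 * \<bar>x\<bar> * \<bar>p\<bar> \<le> (v\<^sub>0\<^sup>2 / \<kappa> * x\<^sup>2 + \<kappa> * p\<^sup>2) / 2"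
proof -
  have "0 \<le> (v\<^sub>0 * \<bar>x\<bar> - \<kappa> * \<bar>p\<bar>)\<^sup>2 / \<kappa>"
    using \<kappa> by simp
  also have "\<dots> = v\<^sub>0\<^sup>2 / \<kappa> * x\<^sup>2 + \<kappa> * p\<^sup>2 - 2 * (v\<^sub>0 * \<bar>x\<bar> * \<bar>p\<bar>)"
    using \<kappa> by (simp add: power2_diff power_mult_distrib field_simps) (simp add: power2_eq_square)
  finally show ?thesis by simp
qed

text \<open>From \<open>g \<le> 1\<close> and \<open>\<delta> * g \<le> f\<close> one gets
  \<open>g\<^sup>2 \<le> g \<le> f / \<delta>\<close> at the value of \<open>U\<close>, so the right
  side of \<open>amgm_flux\<close> is dominated by the energy. It is applied with
  \<open>Us s y\<close> and with \<open>Uy s y\<close> for \<open>p\<close>.\<close>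

lemma cutoff_flux_le:
  assumes "y \<in> {0..H}" and "\<delta> > 0" and g: "0 \<le> g (U s y)" "g (U s y) \<le> 1"
    and gf: "\<delta> * g (U s y) \<le> f (U s y)" and p: "p\<^sup>2 \<le> (Us s y)\<^sup>2 + (Uy s y)\<^sup>2"
  shows "v\<^sub>0 * \<bar>g (U s y)\<bar> * \<bar>p\<bar> \<le> (1 + 1 / \<delta>) / 2 * energy s y"
proof -
  let ?A = "v\<^sub>0\<^sup>2 / \<kappa> * f (U s y)" and ?B = "\<kappa> * ((Us s y)\<^sup>2 + (Uy s y)\<^sup>2)"
  have AB: "0 \<le> ?A" "0 \<le> ?B"
    using \<kappa> f_nonneg[OF U_range[OF assms(1), of s]] by auto
  have "(g (U s y))\<^sup>2 \<le> g (U s y)"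
    using g by (simp add: power2_eq_square mult_left_le)
  also have "\<dots> \<le> f (U s y) / \<delta>"
    using gf \<open>\<delta> > 0\<close> by (simp add: field_simps)
  finally have "v\<^sub>0\<^sup>2 / \<kappa> * (g (U s y))\<^sup>2 \<le> v\<^sub>0\<^sup>2 / \<kappa> * (f (U s y) / \<delta>)"
    using \<kappa> by (intro mult_left_mono) auto
  moreover have "\<kappa> * p\<^sup>2 \<le> ?B"
    using p \<kappa> by (intro mult_left_mono) auto
  moreover have "0 \<le> ?A" "0 \<le> ?B / \<delta>"
    using AB \<open>\<delta> > 0\<close> by auto
  moreover have "(1 + 1 / \<delta>) / 2 * (B + A) = (A + A / \<delta> + B + B / \<delta>) / 2" for A B
    by (simp add: algebra_simps add_divide_distrib)
  then have "(1 + 1 / \<delta>) / 2 * energy s y = (?A + v\<^sub>0\<^sup>2 / \<kappa> * (f (U s y) / \<delta>) + ?B + ?B / \<delta>) / 2"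
    unfolding energy_def times_divide_eq_right[of _ _ \<delta>] .
  moreover have "(X + P) / 2 \<le> (A + Y + B + Z) / 2"
    if "X \<le> Y" "P \<le> B" "0 \<le> A" "0 \<le> Z" for A B P X Y Z :: real
    using that by simp
  ultimately show ?thesis
    using order_trans[OF amgm_flux[of "g (U s y)" p]] by metis
qed

text \<open>Each term of \<open>residual\<close> contributes one summand of the constant: 1 from the
  reaction, \<open>D\<close> from the term with \<open>g'\<close>, and
  \<open>K * (1 + 1 / \<delta>) / 2\<close> from the term with \<open>\<psi>'\<close>, which
  \<open>cutoff_flux_le\<close> controls. The resulting bound is the same for all windows and so
  survives the limit of \<open>weak_identity\<close>.\<close>

lemma drift_bound:
  assumes \<psi>: "\<And>y. y \<in> {0..H} \<Longrightarrow> (\<psi> has_real_derivative \<psi>' y) (at y within {0..H})"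
    and \<psi>': "continuous_on {0..H} \<psi>'" and \<psi>_boundary: "\<psi> 0 = \<psi> H"
    and \<psi>_le: "\<And>y. y \<in> {0..H} \<Longrightarrow> \<bar>\<psi> y\<bar> \<le> 1"
    and \<psi>'_le: "\<And>y. y \<in> {0..H} \<Longrightarrow> \<bar>\<psi>' y\<bar> \<le> K * v\<^sub>0 / \<kappa>" and "K \<ge> 0"
    and G: "\<And>z. (G has_real_derivative g z) (at z)"
    and g: "\<And>z. (g has_real_derivative g' z) (at z)" and g': "continuous_on UNIV g'"
    and g_range: "\<And>z. 0 \<le> g z \<and> g z \<le> 1" and g'_le: "\<And>z. \<bar>g' z\<bar> \<le> D"
    and "\<delta> > 0" and gf: "\<And>z. z \<in> {0..1} \<Longrightarrow> \<delta> * g z \<le> f z"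
  shows "\<bar>(G 1 - G 0) * integral {0..H} (\<lambda>y. (c - u y) * \<psi> y)\<bar>
           \<le> (1 + D + K * (1 + 1 / \<delta>) / 2) * (3 / 2 * c * H)"
proof -
  let ?C = "1 + D + K * (1 + 1 / \<delta>) / 2"
  have D: "D \<ge> 0"
    using g'_le[of 0] by linarith
  obtain a b where "\<forall>n. a n \<le> - real n" "\<forall>n. real n \<le> b n" and
    lim: "(\<lambda>n. integral {a n..b n} (\<lambda>s. integral {0..H} (residual \<psi> \<psi>' g g' s)))
       \<longlonglongrightarrow> (G 1 - G 0) * integral {0..H} (\<lambda>y. (c - u y) * \<psi> y)"
    by (rule weak_identity[OF \<psi> \<psi>' \<psi>_boundary G g g'])
  have cg: "continuous_on UNIV g"
    by (rule DERIV_continuous_on, rule g)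
  have c\<psi>: "continuous_on {0..H} \<psi>"
    using \<psi> by (rule DERIV_continuous_on)
  have sr: "strip_continuous (residual \<psi> \<psi>' g g')"
    unfolding strip_continuous_def residual_def
    by (intro strip_intros cg g' \<psi>' c\<psi>) (use \<kappa> in auto)
  have r_le: "\<bar>residual \<psi> \<psi>' g g' s y\<bar> \<le> ?C * energy s y" if y: "y \<in> {0..H}" for s y
  proof -
    let ?z = "U s y" and ?E = "energy s y"
    let ?A = "v\<^sub>0\<^sup>2 / \<kappa> * f ?z" and ?B = "\<kappa> * ((Us s y)\<^sup>2 + (Uy s y)\<^sup>2)"
    have f: "f ?z \<ge> 0"
      by (rule f_nonneg[OF U_range[OF y]])
    have g_abs: "\<bar>g ?z\<bar> \<le> 1"
      using g_range[of ?z] by simp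
    have "\<bar>\<psi> y\<bar> * \<bar>g ?z\<bar> \<le> 1 * 1"
      by (intro mult_mono \<psi>_le y g_abs) auto
    then have "\<bar>\<psi> y * g ?z\<bar> * f ?z \<le> 1 * f ?z"
      using f by (intro mult_right_mono) (auto simp: abs_mult)
    then have 1: "\<bar>v\<^sub>0\<^sup>2 / \<kappa> * (\<psi> y * g ?z * f ?z)\<bar> \<le> ?A"
      using \<kappa> f by (simp add: abs_mult divide_right_mono mult_left_mono)
    have "\<bar>\<psi> y\<bar> * \<bar>g' ?z\<bar> \<le> 1 * D"
      by (intro mult_mono \<psi>_le y g'_le) auto
    then have "\<bar>\<psi> y * g' ?z\<bar> * ?B \<le> D * ?B"
      using \<kappa> by (intro mult_right_mono) (auto simp: abs_mult)
    then have 2: "\<bar>\<kappa> * (\<psi> y * g' ?z * ((Us s y)\<^sup>2 + (Uy s y)\<^sup>2))\<bar> \<le> D * ?B"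
      using \<kappa> by (simp add: abs_mult mult_ac)
    have "\<kappa> * \<bar>\<psi>' y\<bar> \<le> K * v\<^sub>0"
      using \<psi>'_le[OF y] \<kappa> by (simp add: field_simps)
    then have "(\<kappa> * \<bar>\<psi>' y\<bar>) * (\<bar>g ?z\<bar> * \<bar>Uy s y\<bar>) \<le> (K * v\<^sub>0) * (\<bar>g ?z\<bar> * \<bar>Uy s y\<bar>)"
      by (intro mult_right_mono) auto
    also have "\<dots> = K * (v\<^sub>0 * \<bar>g ?z\<bar> * \<bar>Uy s y\<bar>)"
      by simp
    also have "\<dots> \<le> K * ((1 + 1 / \<delta>) / 2 * ?E)"
      using g_range gf[OF U_range[OF y]]
      by (intro mult_left_mono cutoff_flux_le y \<open>\<delta> > 0\<close> \<open>K \<ge> 0\<close>) auto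
    finally have 3: "\<bar>\<kappa> * (\<psi>' y * g ?z * Uy s y)\<bar> \<le> K * (1 + 1 / \<delta>) / 2 * ?E"
      using \<kappa> by (simp add: abs_mult mult.assoc)
    have "0 \<le> D * ?A"
      using D f \<kappa> by simp
    moreover have "0 \<le> ?B"
      using \<kappa> by simp
    moreover have "?C * ?E = ?E + D * ?E + K * (1 + 1 / \<delta>) / 2 * ?E"
      by (simp only: distrib_right mult_1)
    moreover have "?E = ?B + ?A" "D * ?E = D * ?B + D * ?A"
      by (simp_all only: energy_def distrib_left)
    ultimately show ?thesis
      unfolding residual_def using 1 2 3 by linarith
  qed
  have "?C \<ge> 0"
    using D \<open>K \<ge> 0\<close> \<open>\<delta> > 0\<close> by simp
  then have "\<bar>integral {a n..b n} (\<lambda>s. integral {0..H} (residual \<psi> \<psi>' g g' s))\<bar> \<le> ?C * (3 / 2 * c * H)" for n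
    by (rule abs_integral_le_speed[OF sr _ r_le])
  then show ?thesis
    by (intro LIMSEQ_le_const2[OF tendsto_rabs[OF lim]]) auto
qed

text \<open>On each line \<open>G (U s y)\<close> passes from \<open>G 1\<close> to
  \<open>G 0\<close>, and \<open>cutoff_flux_le\<close> with \<open>Us s y\<close> for
  \<open>p\<close> pays for this change. Since \<open>G (U s y)\<close> itself converges at both
  ends, the plain windows \<open>{- real n..real n}\<close> suffice; the factor \<open>H\<close>
  cancels.\<close>

lemma laminar_bound:
  assumes G: "\<And>z. (G has_real_derivative g z) (at z)" and g: "continuous_on UNIV g"
    and g_range: "\<And>z. 0 \<le> g z \<and> g z \<le> 1"
    and "\<delta> > 0" and gf: "\<And>z. z \<in> {0..1} \<Longrightarrow> \<delta> * g z \<le> f z"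
  shows "v\<^sub>0 * (G 1 - G 0) \<le> (1 + 1 / \<delta>) / 2 * (3 / 2 * c)"
proof -
  let ?C = "(1 + 1 / \<delta>) / 2"
  have cG: "continuous_on UNIV G"
    by (rule DERIV_continuous_on, rule G)
  let ?F = "\<lambda>s y. v\<^sub>0 * G (U s y)" and ?F' = "\<lambda>s y. v\<^sub>0 * (g (U s y) * Us s y)"
  have sc: "strip_continuous ?F" "strip_continuous ?F'"
    unfolding strip_continuous_def by (intro strip_intros cG g)+
  have deriv: "((\<lambda>s. ?F s y) has_real_derivative ?F' s y) (at s)" if "y \<in> {0..H}" for s y
    by (rule derivative_eq_intros DERIV_chain2[OF G U_s[OF that]] refl)+ simp
  have le: "\<bar>?F' s y\<bar> \<le> ?C * energy s y" if y: "y \<in> {0..H}" for s y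
    using cutoff_flux_le[OF y \<open>\<delta> > 0\<close>, of g s "Us s y"] g_range gf[OF U_range[OF y]] v\<^sub>0
    by (simp add: abs_mult mult.assoc)
  have bound: "integral {0..H} (?F (- real n)) - integral {0..H} (?F (real n)) \<le> ?C * (3 / 2 * c * H)" for n
  proof -
    have "\<bar>integral {- real n..real n} (\<lambda>s. integral {0..H} (?F' s))\<bar> \<le> ?C * (3 / 2 * c * H)"
      by (rule abs_integral_le_speed[OF sc(2) _ le]) (use \<open>\<delta> > 0\<close> in auto)
    moreover have "integral {- real n..real n} (\<lambda>s. integral {0..H} (?F' s)) =
        integral {0..H} (?F (real n)) - integral {0..H} (?F (- real n))"
      by (rule strip_derivative_integral[OF deriv sc]) auto
    ultimately show ?thesis
      by linarith
  qed
  have lim0: "(\<lambda>n. integral {0..H} (?F (- real n))) \<longlonglongrightarrow> integral {0..H} (\<lambda>y. v\<^sub>0 * G 1)"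
    by (intro weighted_limit filterlim_compose[OF U_at_bot] cG continuous_intros)
       (auto simp: filterlim_uminus_at_bot filterlim_real_sequentially)
  have lim1: "(\<lambda>n. integral {0..H} (?F (real n))) \<longlonglongrightarrow> integral {0..H} (\<lambda>y. v\<^sub>0 * G 0)"
    by (intro weighted_limit filterlim_compose[OF U_at_top] cG continuous_intros)
       (auto simp: filterlim_real_sequentially)
  have "integral {0..H} (\<lambda>y. v\<^sub>0 * G 1) - integral {0..H} (\<lambda>y. v\<^sub>0 * G 0) \<le> ?C * (3 / 2 * c * H)"
    by (intro LIMSEQ_le_const2[OF tendsto_diff[OF lim0 lim1]] exI[of _ 0] allI impI bound)
  then have "(v\<^sub>0 * (G 1 - G 0)) * H \<le> (?C * (3 / 2 * c)) * H"
    using H by (simp add: algebra_simps)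
  then show ?thesis
    using H by (simp only: mult_le_cancel_right_pos)
qed

text \<open>The weights \<open>w\<^sub>j = (1 + l / h\<^sub>j)\<^sup>-\<^sup>1\<close> satisfy \<open>w\<^sub>j / h\<^sub>j \<le> 1 / l\<close>, so a sum of disjoint bumps of width
  \<open>h\<^sub>j\<close> and height \<open>w\<^sub>j\<close> is a single test function with \<open>\<bar>\<psi>\<bar> \<le> 1\<close> and \<open>\<bar>\<psi>'\<bar> \<le> 4 / l\<close>.\<close>

lemma interval_sum_bound:
  assumes "finite J" and disj: "disjoint_family_on (\<lambda>j. {m j - h j<..<m j + h j}) J"
    and h: "\<And>j. j \<in> J \<Longrightarrow> h j > 0"
    and sub: "\<And>j. j \<in> J \<Longrightarrow> {m j - h j<..<m j + h j} \<subseteq> {0..H}"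
    and N: "\<And>j y. j \<in> J \<Longrightarrow> y \<in> {m j - h j<..<m j + h j} \<Longrightarrow> N j / 2 \<le> \<bar>u y\<bar> \<and> \<bar>u y\<bar> \<le> N j"
    and G: "\<And>z. (G has_real_derivative g z) (at z)"
    and g: "\<And>z. (g has_real_derivative g' z) (at z)" and g': "continuous_on UNIV g'"
    and g_range: "\<And>z. 0 \<le> g z \<and> g z \<le> 1" and g'_le: "\<And>z. \<bar>g' z\<bar> \<le> D"
    and "\<delta> > 0" and gf: "\<And>z. z \<in> {0..1} \<Longrightarrow> \<delta> * g z \<le> f z"
    and "c \<ge> 0" and G01: "G 0 \<le> G 1"
  shows "(G 1 - G 0) * (\<Sum>j\<in>J. inverse (1 + \<kappa> / v\<^sub>0 / h j) *
            (integral {m j - h j..m j + h j} (\<lambda>y. \<bar>u y\<bar>) / H))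
         \<le> 8 * (G 1 - G 0 + 3 / 2 * (1 + D + 2 * (1 + 1 / \<delta>))) * c"
proof -
  let ?I = "\<lambda>j. {m j - h j<..<m j + h j}"
  \<comment> \<open>\<open>?C\<close> is the constant of \<open>drift_bound\<close> for
    \<open>K = 4\<close>, the number 4 being the bound of \<open>abs_bump'_le\<close>.\<close>
  let ?\<gamma> = "G 1 - G 0" and ?C = "1 + D + 4 * (1 + 1 / \<delta>) / 2"
  define w where "w j = inverse (1 + \<kappa> / v\<^sub>0 / h j)" for j
  define \<psi> where "\<psi> y = (\<Sum>j\<in>J. w j * (sgn (u (m j)) * bump ((y - m j) / h j)))" for y
  define \<psi>' where "\<psi>' y = (\<Sum>j\<in>J. w j * (sgn (u (m j)) * (bump' ((y - m j) / h j) / h j)))" for y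
  have w: "0 \<le> w j" "w j \<le> 1" "w j / h j \<le> v\<^sub>0 / \<kappa>" if "j \<in> J" for j
  proof -
    have hj: "h j > 0" and l: "\<kappa> / v\<^sub>0 > 0" "\<kappa> / v\<^sub>0 / h j > 0"
      using h[OF that] \<kappa> v\<^sub>0 by auto
    then show "0 \<le> w j" "w j \<le> 1"
      by (auto simp: w_def inverse_eq_divide divide_le_eq)
    have "1 + \<kappa> / v\<^sub>0 / h j = (h j + \<kappa> / v\<^sub>0) / h j"
      using hj by (simp add: add_divide_distrib)
    then have "w j / h j = 1 / (h j + \<kappa> / v\<^sub>0)"
      using hj by (simp add: w_def)
    also have "\<dots> \<le> 1 / (\<kappa> / v\<^sub>0)"
      using hj l by (intro frac_le) auto
    finally show "w j / h j \<le> v\<^sub>0 / \<kappa>"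
      by simp
  qed
  have \<psi>: "(\<psi> has_real_derivative \<psi>' y) (at y within {0..H})" for y
    unfolding \<psi>_def[abs_def] \<psi>'_def
    by (rule DERIV_sum, rule DERIV_cmult, rule DERIV_cmult, rule has_field_derivative_at_within,
        rule bump_scaled_has_real_derivative)
  have c\<psi>': "continuous_on {0..H} \<psi>'" and c\<psi>: "continuous_on {0..H} \<psi>"
    unfolding \<psi>_def[abs_def] \<psi>'_def[abs_def] divide_inverse by (intro continuous_intros)+
  have sgn_le: "\<bar>sgn x\<bar> \<le> 1" for x :: real
    by (simp add: abs_sgn_eq)
  have \<psi>_le: "\<bar>\<psi> y\<bar> \<le> 1" for y
    unfolding \<psi>_def
  proof (rule abs_sum_disjoint_le[OF \<open>finite J\<close> disj])
    fix j assume j: "j \<in> J"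
    show "w j * (sgn (u (m j)) * bump ((y - m j) / h j)) = 0" if "y \<notin> ?I j"
      using bump_outside[OF scaled_outside[OF h[OF j] that]] by simp
    have "\<bar>w j\<bar> * (\<bar>sgn (u (m j))\<bar> * \<bar>bump ((y - m j) / h j)\<bar>) \<le> 1 * (1 * 1)"
      using w[OF j] by (intro mult_mono sgn_le) (auto simp: bump_nonneg bump_le_1)
    then show "\<bar>w j * (sgn (u (m j)) * bump ((y - m j) / h j))\<bar> \<le> 1"
      by (simp add: abs_mult)
  qed auto
  have \<psi>'_le: "\<bar>\<psi>' y\<bar> \<le> 4 * v\<^sub>0 / \<kappa>" for y
    unfolding \<psi>'_def
  proof (rule abs_sum_disjoint_le[OF \<open>finite J\<close> disj])
    fix j assume j: "j \<in> J"
    show "w j * (sgn (u (m j)) * (bump' ((y - m j) / h j) / h j)) = 0" if "y \<notin> ?I j"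
      using bump'_outside[OF scaled_outside[OF h[OF j] that]] by simp
    have "(w j / h j) * (\<bar>sgn (u (m j))\<bar> * \<bar>bump' ((y - m j) / h j)\<bar>) \<le> v\<^sub>0 / \<kappa> * (1 * 4)"
      using w[OF j] h[OF j] \<kappa> v\<^sub>0 by (intro mult_mono sgn_le abs_bump'_le) auto
    then show "\<bar>w j * (sgn (u (m j)) * (bump' ((y - m j) / h j) / h j))\<bar> \<le> 4 * v\<^sub>0 / \<kappa>"
      using w[OF j] h[OF j] by (simp add: abs_mult mult_ac)
  qed (use \<kappa> v\<^sub>0 in auto)
  \<comment> \<open>Every interval lies in \<open>{0..H}\<close>, so all bumps vanish at both ends.
    This supplies the condition \<open>\<psi> 0 = \<psi> H\<close> of
    \<open>drift_bound\<close>.\<close>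
  have \<psi>_zero: "\<psi> y = 0" if "y = 0 \<or> y = H" for y
    unfolding \<psi>_def
  proof (intro sum.neutral ballI)
    fix j assume j: "j \<in> J"
    have "0 \<le> m j - h j" "m j + h j \<le> H"
      using sub[OF j] h[OF j] by (auto simp: greaterThanLessThan_subseteq_atLeastAtMost_iff)
    then have "y \<notin> ?I j"
      using that by auto
    then show "w j * (sgn (u (m j)) * bump ((y - m j) / h j)) = 0"
      using bump_outside[OF scaled_outside[OF h[OF j]]] by simp
  qed
  have drift: "\<bar>?\<gamma> * integral {0..H} (\<lambda>y. (c - u y) * \<psi> y)\<bar> \<le> ?C * (3 / 2 * c * H)"
    by (rule drift_bound[OF \<psi> c\<psi>' _ \<psi>_le \<psi>'_le _ G g g' g_range g'_le \<open>\<delta> > 0\<close> gf])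
       (use \<psi>_zero in auto)
  \<comment> \<open>In the splitting of \<open>(c - u y) * \<psi> y\<close> the part with
    \<open>c\<close> costs at most \<open>c * H\<close>, by
    \<open>\<bar>\<psi> y\<bar> \<le> 1\<close>; this is the origin of the summand
    \<open>G 1 - G 0\<close> in the final constant.\<close>
  have "norm (integral {0..H} \<psi>) \<le> integral {0..H} (\<lambda>_. 1)"
    by (intro integral_norm_bound_integral integrable_continuous_real c\<psi>) (use \<psi>_le in auto)
  then have "integral {0..H} \<psi> \<le> H"
    using H by simp
  then have "c * integral {0..H} \<psi> \<le> c * H"
    using \<open>c \<ge> 0\<close> by (rule mult_left_mono)
  then have "?\<gamma> * (c * integral {0..H} \<psi>) \<le> ?\<gamma> * (c * H)"
    by (rule mult_left_mono) (use G01 in simp)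
  moreover have "integral {0..H} (\<lambda>y. (c - u y) * \<psi> y) =
      c * integral {0..H} \<psi> - integral {0..H} (\<lambda>y. u y * \<psi> y)"
    unfolding left_diff_distrib
    by (subst integral_diff) (auto intro!: integrable_continuous_real continuous_intros cont_u c\<psi>)
  then have "?\<gamma> * integral {0..H} (\<lambda>y. (c - u y) * \<psi> y) =
      ?\<gamma> * (c * integral {0..H} \<psi>) - ?\<gamma> * integral {0..H} (\<lambda>y. u y * \<psi> y)"
    by (simp only: right_diff_distrib)
  ultimately have u\<psi>: "?\<gamma> * integral {0..H} (\<lambda>y. u y * \<psi> y) \<le> ?\<gamma> * (c * H) + ?C * (3 / 2 * c * H)"
    using drift by linarith
  \<comment> \<open>Each integral of \<open>\<bar>u y\<bar>\<close> is traded for a bump integral at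
    the price of 8, and the weighted signed bumps add up to \<open>\<psi>\<close>.\<close>
  have "(\<Sum>j\<in>J. w j * integral {m j - h j..m j + h j} (\<lambda>y. \<bar>u y\<bar>)) \<le>
      (\<Sum>j\<in>J. w j * (8 * integral {0..H} (\<lambda>y. u y * (sgn (u (m j)) * bump ((y - m j) / h j)))))"
  proof (intro sum_mono mult_left_mono w)
    fix j assume j: "j \<in> J"
    show "integral {m j - h j..m j + h j} (\<lambda>y. \<bar>u y\<bar>) \<le>
        8 * integral {0..H} (\<lambda>y. u y * (sgn (u (m j)) * bump ((y - m j) / h j)))"
      by (rule integral_abs_le_bump[OF cont_u h[OF j] sub[OF j] N[OF j]])
  qed
  also have "\<dots> = 8 * (\<Sum>j\<in>J. integral {0..H} (\<lambda>y. w j * (u y * (sgn (u (m j)) * bump ((y - m j) / h j)))))"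
    unfolding integral_mult_right sum_distrib_left by (simp only: mult.left_commute)
  also have "(\<Sum>j\<in>J. integral {0..H} (\<lambda>y. w j * (u y * (sgn (u (m j)) * bump ((y - m j) / h j))))) =
      integral {0..H} (\<lambda>y. \<Sum>j\<in>J. w j * (u y * (sgn (u (m j)) * bump ((y - m j) / h j))))"
    unfolding divide_inverse
    by (intro integral_sum[symmetric] \<open>finite J\<close> integrable_continuous_real continuous_intros cont_u)
  also have "\<dots> = integral {0..H} (\<lambda>y. u y * \<psi> y)"
    by (simp add: \<psi>_def sum_distrib_left mult_ac)
  finally have "?\<gamma> * (\<Sum>j\<in>J. w j * integral {m j - h j..m j + h j} (\<lambda>y. \<bar>u y\<bar>)) \<le>
      ?\<gamma> * (8 * integral {0..H} (\<lambda>y. u y * \<psi> y))"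
    using G01 by (intro mult_left_mono) auto
  also have "\<dots> \<le> 8 * (?\<gamma> * (c * H) + ?C * (3 / 2 * c * H))"
    using mult_left_mono[OF u\<psi>, of 8] by (simp only: mult.left_commute[of 8] zero_le_numeral)
  also have "\<dots> = 8 * (?\<gamma> + 3 / 2 * (1 + D + 2 * (1 + 1 / \<delta>))) * c * H"
    by (simp add: algebra_simps)
  finally have "?\<gamma> * (\<Sum>j\<in>J. w j * integral {m j - h j..m j + h j} (\<lambda>y. \<bar>u y\<bar>)) / H \<le>
      8 * (?\<gamma> + 3 / 2 * (1 + D + 2 * (1 + 1 / \<delta>))) * c"
    using H by (simp add: divide_le_eq)
  then show ?thesis
    by (simp only: w_def times_divide_eq_right sum_divide_distrib[symmetric])
qed

end

subsection \<open>The speed bound\<close>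

text \<open>At \<open>t = 0\<close> the solution coincides with \<open>U\<close>, so the profile
  derivatives are those of \<open>T\<close> at time 0. The chain rule along \<open>s - c * t\<close>
  turns the time derivative into \<open>- c\<close> times the \<open>x\<close>-derivative.\<close>

lemma traveling_front_profile:
  assumes pos: "\<kappa> > 0" "v\<^sub>0 > 0" "H > 0" and u: "C1_on {0..H} u" "integral {0..H} u = 0"
    and front: "traveling_front \<kappa> v\<^sub>0 H u f c U" and f: "reaction f"
  obtains Us Uy Uss Uyy where "front_profile \<kappa> v\<^sub>0 H c u f U Us Uy Uss Uyy"
proof -
  define T where "T = (\<lambda>x y t. U (x - c * t) y)"
  have sol: "strip_solution \<kappa> v\<^sub>0 H u f T" and bc: "neumann_bc H T \<or> periodic_bc H T"
    and lim: "\<And>y. y \<in> {0..H} \<Longrightarrow> (\<forall>s. U s y \<in> {0..1}) \<and>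
        ((\<lambda>s. U s y) \<longlongrightarrow> 1) at_bot \<and> ((\<lambda>s. U s y) \<longlongrightarrow> 0) at_top"
    using front by (simp_all add: traveling_front_def T_def Let_def)
  obtain Tt Tx Ty Txx Tyy where
    deriv': "\<forall>x t. \<forall>y\<in>{0..H}.
       ((\<lambda>t. T x y t) has_real_derivative Tt x y t) (at t) \<and>
       ((\<lambda>x. T x y t) has_real_derivative Tx x y t) (at x) \<and>
       ((\<lambda>x. Tx x y t) has_real_derivative Txx x y t) (at x) \<and>
       ((\<lambda>y. T x y t) has_real_derivative Ty x y t) (at y within {0..H}) \<and>
       ((\<lambda>y. Ty x y t) has_real_derivative Tyy x y t) (at y within {0..H}) \<and>
       Tt x y t + u y * Tx x y t =
         \<kappa> * (Txx x y t + Tyy x y t) + v\<^sub>0\<^sup>2 / \<kappa> * f (T x y t)" and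
    cont: "\<forall>F\<in>{T, Tt, Tx, Ty, Txx, Tyy}.
       continuous_on (UNIV \<times> {0..H} \<times> UNIV) (\<lambda>(x, y, t). F x y t)"
    using sol unfolding strip_solution_def by (elim exE conjE)
  note deriv = deriv'[rule_format]
  have U_eq: "U s y = T s y 0" for s y
    by (simp add: T_def)
  have cont0: "continuous_on (UNIV \<times> {0..H}) (\<lambda>p. F (fst p) (snd p) 0)"
    if "F \<in> {T, Tt, Tx, Ty, Txx, Tyy}" for F
  proof -
    have "continuous_on (UNIV \<times> {0..H}) (\<lambda>p. (\<lambda>(x, y, t). F x y t) (fst p, snd p, 0))"
      by (rule continuous_on_compose2[OF cont[rule_format, OF that]]) (auto intro!: continuous_intros)
    then show ?thesis by simp
  qed
  have Tt_eq: "Tt s y 0 = - c * Tx s y 0" if y: "y \<in> {0..H}" for s y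
  proof -
    have "((\<lambda>s. U s y) has_real_derivative Tx s y 0) (at s)"
      using deriv[OF y, of s 0] by (simp add: U_eq)
    then have "((\<lambda>s. U s y) has_real_derivative Tx s y 0) (at (s - c * 0))"
      by simp
    moreover have "((\<lambda>t. s - c * t) has_real_derivative - c) (at 0)"
      by (auto intro!: derivative_eq_intros)
    ultimately have "((\<lambda>t. U (s - c * t) y) has_real_derivative Tx s y 0 * - c) (at 0)"
      by (rule DERIV_chain2)
    moreover have "((\<lambda>t. U (s - c * t) y) has_real_derivative Tt s y 0) (at 0)"
      using deriv[OF y, of s 0] by (simp add: T_def)
    ultimately have "Tx s y 0 * - c = Tt s y 0"
      by (rule DERIV_unique)
    then show ?thesis
      by (simp add: mult.commute)
  qed
  have Ty: "(U s has_real_derivative Ty s y 0) (at y within {0..H})" if "y \<in> {0..H}" for s y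
    using deriv[OF that, of s 0] by (simp add: U_eq[abs_def])
  have ends: "0 \<in> {0..H}" "H \<in> {0..H}"
    using pos by auto
  have boundary: "Ty s 0 0 = 0 \<and> Ty s H 0 = 0 \<or> U s 0 = U s H \<and> Ty s 0 0 = Ty s H 0" for s
    using bc
  proof
    assume N: "neumann_bc H T"
    have "Ty s y 0 = 0" if "y \<in> {0, H}" for y
    proof -
      have y: "y \<in> {0..H}"
        using that ends by auto
      have "(U s has_real_derivative 0) (at y within {0..H})"
        using N that by (auto simp: neumann_bc_def U_eq[abs_def])
      then show ?thesis
        by (rule has_real_derivative_unique_Icc[OF \<open>H > 0\<close> y Ty[OF y]])
    qed
    then show ?thesis by simp
  next
    assume P: "periodic_bc H T"
    have shift: "U s (y + H) = U s y" for y
      using P by (simp add: periodic_bc_def U_eq)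
    \<comment> \<open>The two-sided derivative \<open>E\<close> at \<open>H\<close> is carried to 0
      by the shift through one period; its one-sided restrictions are the values of
      \<open>Ty\<close> at the two ends.\<close>
    have "U s differentiable (at H)"
      using P by (simp add: periodic_bc_def U_eq[abs_def])
    then obtain E where E: "(U s has_real_derivative E) (at H)"
      unfolding real_differentiable_def by blast
    have "((\<lambda>y. U s (y + H)) has_real_derivative E) (at 0)"
      using E DERIV_shift[of "U s" E 0 H] by simp
    then have "(U s has_real_derivative E) (at 0)"
      by (simp add: shift)
    with E have "Ty s 0 0 = E" "Ty s H 0 = E"
      by (auto intro!: has_real_derivative_unique_Icc[OF \<open>H > 0\<close> _ Ty has_field_derivative_at_within] ends)
    moreover have "U s 0 = U s H"
      using shift[of 0] by simp
    ultimately show ?thesis by simp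
  qed
  obtain u' where u': "\<And>y. y \<in> {0..H} \<Longrightarrow> (u has_real_derivative u' y) (at y within {0..H})"
    using u(1) unfolding C1_on_def by blast
  obtain f' where f': "\<And>z. z \<in> {0..1} \<Longrightarrow> (f has_real_derivative f' z) (at z within {0..1})"
    using f unfolding reaction_def C1_on_def by blast
  have f_nonneg: "f z \<ge> 0" if "z \<in> {0..1}" for z
    using f that unfolding reaction_def by (cases "z = 0 \<or> z = 1") auto
  have "front_profile \<kappa> v\<^sub>0 H c u f U (\<lambda>s y. Tx s y 0) (\<lambda>s y. Ty s y 0) (\<lambda>s y. Txx s y 0) (\<lambda>s y. Tyy s y 0)"
  proof
    fix s y assume y: "y \<in> {0..H}"
    show "((\<lambda>s. U s y) has_real_derivative Tx s y 0) (at s)"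
      "((\<lambda>s. Tx s y 0) has_real_derivative Txx s y 0) (at s)"
      "((\<lambda>y. Ty s y 0) has_real_derivative Tyy s y 0) (at y within {0..H})"
      using deriv[OF y, of s 0] by (simp_all add: U_eq)
    show "(U s has_real_derivative Ty s y 0) (at y within {0..H})"
      by (rule Ty[OF y])
    show "(u y - c) * Tx s y 0 = \<kappa> * (Txx s y 0 + Tyy s y 0) + v\<^sub>0\<^sup>2 / \<kappa> * f (U s y)"
      using deriv[OF y, of s 0] by (simp add: U_eq Tt_eq[OF y] left_diff_distrib)
    show "U s y \<in> {0..1}" "((\<lambda>s. U s y) \<longlongrightarrow> 1) at_bot" "((\<lambda>s. U s y) \<longlongrightarrow> 0) at_top"
      using lim[OF y] by auto
  next
    show "continuous_on {0..H} u"
      using u' by (rule DERIV_continuous_on)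
    show "continuous_on {0..1} f"
      using f' by (rule DERIV_continuous_on)
    show "continuous_on (UNIV \<times> {0..H}) (\<lambda>p. U (fst p) (snd p))"
      unfolding U_eq by (rule cont0) simp
  qed (use pos u(2) boundary f_nonneg in \<open>auto intro: cont0\<close>)
  then show ?thesis
    by (rule that)
qed

text \<open>A point where \<open>f\<close> does not vanish is interior, and \<open>f\<close> is
  positive there. Continuity keeps \<open>f\<close> above half that value nearby, which treats
  ignition and KPP nonlinearities alike.\<close>

lemma reaction_window:
  assumes "reaction f"
  obtains m r \<delta> :: real where "r > 0" "\<delta> > 0" "{m - r..m + r} \<subseteq> {0..1}"
    "\<forall>z\<in>{m - r..m + r}. \<delta> \<le> f z"
proof -
  have f: "f 0 = 0" "f 1 = 0" "\<And>z. z \<in> {0<..<1} \<Longrightarrow> f z \<ge> 0"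
    using assms by (auto simp: reaction_def)
  obtain m where m: "m \<in> {0..1}" "f m \<noteq> 0"
    using assms by (auto simp: reaction_def)
  with f have m01: "m \<in> {0<..<1}"
    by (cases "m = 0 \<or> m = 1") auto
  with m f have fm: "f m > 0"
    by (metis order_le_less)
  obtain f' where "\<And>z. z \<in> {0..1} \<Longrightarrow> (f has_real_derivative f' z) (at z within {0..1})"
    using assms unfolding reaction_def C1_on_def by blast
  then have "continuous_on {0..1} f"
    by (rule DERIV_continuous_on)
  then obtain d where d: "d > 0" "\<And>z. z \<in> {0..1} \<Longrightarrow> dist z m < d \<Longrightarrow> dist (f z) (f m) < f m / 2"
    unfolding continuous_on_iff using m(1) fm by (meson half_gt_zero)
  \<comment> \<open>Halving \<open>d\<close> fits the closed window into the open ball of radius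
    \<open>d\<close>; the other minimum keeps it inside \<open>{0..1}\<close>.\<close>
  define r where "r = min (d / 2) (min m (1 - m))"
  have r: "r > 0" "r < d" "{m - r..m + r} \<subseteq> {0..1}"
    using d(1) m01 by (auto simp: r_def)
  have "f m / 2 \<le> f z" if "z \<in> {m - r..m + r}" for z
  proof -
    have "dist z m < d"
      using that r by (auto simp: dist_real_def)
    then have "\<bar>f z - f m\<bar> < f m / 2"
      using d(2)[of z] that r by (auto simp: dist_real_def)
    then show ?thesis by linarith
  qed
  then show ?thesis
    using that[of r "f m / 2" m] r fm by simp
qed

text \<open>The cutoff is a bump on a window where \<open>f \<ge> \<delta>\<close>, and vanishes
  where \<open>f\<close> may be 0. All data are built from \<open>f\<close> alone, which is what
  makes the final constant independent of the flow.\<close>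

lemma reaction_cutoff:
  assumes "reaction f"
  obtains G g g' :: "real \<Rightarrow> real" and \<delta> D :: real where
    "\<forall>z. (G has_real_derivative g z) (at z)" "\<forall>z. (g has_real_derivative g' z) (at z)"
    "continuous_on UNIV g'" "\<forall>z. 0 \<le> g z \<and> g z \<le> 1" "\<forall>z. \<bar>g' z\<bar> \<le> D"
    "\<delta> > 0" "\<forall>z\<in>{0..1}. \<delta> * g z \<le> f z" "G 0 < G 1"
proof -
  obtain m r \<delta> :: real where r: "r > 0" and \<delta>: "\<delta> > 0" and sub: "{m - r..m + r} \<subseteq> {0..1}"
    and f_ge: "\<forall>z\<in>{m - r..m + r}. \<delta> \<le> f z"
    by (rule reaction_window[OF assms])
  define g where "g z = bump ((z - m) / r)" for z
  define g' where "g' z = bump' ((z - m) / r) / r" for z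
  have g: "(g has_real_derivative g' z) (at z)" for z
    unfolding g_def[abs_def] g'_def by (rule bump_scaled_has_real_derivative)
  have cg: "continuous_on UNIV g"
    by (rule DERIV_continuous_on, rule g)
  obtain G where G: "\<forall>z. (G has_real_derivative g z) (at z)"
    by (rule continuous_has_primitive[OF cg])
  have bounds: "0 \<le> m - r" "m + r \<le> 1"
    using sub r by auto
  have mono: "G a \<le> G b" if "a \<le> b" for a b
    by (rule DERIV_nonneg_imp_nondecreasing[OF that]) (use G in \<open>auto simp: g_def bump_nonneg\<close>)
  have "G (m - r / 2) < G (m + r / 2)"
  proof (rule DERIV_pos_imp_increasing[where f = G])
    fix z assume "m - r / 2 \<le> z" "z \<le> m + r / 2"
    then have "\<bar>(z - m) / r\<bar> < 1"
      using r by (auto simp: abs_divide divide_less_eq)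
    then have "g z > 0"
      unfolding g_def by (rule bump_pos)
    then show "\<exists>y. (G has_real_derivative y) (at z) \<and> 0 < y"
      using G by blast
  qed (use r in auto)
  moreover have "G 0 \<le> G (m - r / 2)" "G (m + r / 2) \<le> G 1"
    using bounds r by (auto intro!: mono)
  ultimately have "G 0 < G 1"
    by linarith
  moreover have "continuous_on UNIV g'"
    unfolding g'_def[abs_def] divide_inverse by (intro continuous_intros)
  moreover have "\<forall>z. 0 \<le> g z \<and> g z \<le> 1"
    by (simp add: g_def bump_nonneg bump_le_1)
  moreover have "\<forall>z. \<bar>g' z\<bar> \<le> 4 / r"
    using r by (simp add: g'_def abs_divide divide_right_mono abs_bump'_le)
  moreover have "\<forall>z\<in>{0..1}. \<delta> * g z \<le> f z"
  proof
    fix z :: real assume z: "z \<in> {0..1}"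
    show "\<delta> * g z \<le> f z"
    proof (cases "z \<in> {m - r..m + r}")
      case True
      have "\<delta> * g z \<le> \<delta> * 1"
        using \<delta> by (intro mult_left_mono) (auto simp: g_def bump_le_1)
      with f_ge[rule_format, OF True] show ?thesis by simp
    next
      case False
      then have "g z = 0"
        unfolding g_def by (intro bump_outside scaled_outside r) auto
      moreover have "f z \<ge> 0"
        using assms z unfolding reaction_def by (cases "z = 0 \<or> z = 1") auto
      ultimately show ?thesis by simp
    qed
  qed
  ultimately show ?thesis
    using that[of G g g' "4 / r" \<delta>] G g \<delta> by blast
qed

text \<open>The laminar bound gives \<open>v\<^sub>0 \<le> M\<^sub>1 * c\<close> and the test with
  bumps bounds the sum by \<open>M\<^sub>2 * c\<close>; adding the two yields
  \<open>C = 1 / (M\<^sub>1 + M\<^sub>2)\<close>. Summability is part of the claim because an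
  infinite sum that does not converge is 0 by convention.\<close>

theorem corollary1:
  fixes f :: "real \<Rightarrow> real"
  assumes "ignition f \<or> general_KPP f"
  shows "\<exists>C>0. \<forall>\<kappa>>0. \<forall>v\<^sub>0>0. \<forall>H>0. \<forall>(u :: real \<Rightarrow> real) (c :: real) (U :: real \<Rightarrow> real \<Rightarrow> real)
            (J :: nat set) (m :: nat \<Rightarrow> real) (h :: nat \<Rightarrow> real).
           C1_on {0..H} u \<and> integral {0..H} u = 0 \<and>
           traveling_front \<kappa> v\<^sub>0 H u f c U \<and>
           admissible_intervals H u J m h \<longrightarrow>
           (let l = \<kappa> / v\<^sub>0;
                S = (\<lambda>j. inverse (1 + l / h j) * (integral {m j - h j..m j + h j} (\<lambda>y. \<bar>u y\<bar>) / H))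
            in S summable_on J \<and> c \<ge> C * (v\<^sub>0 + (\<Sum>\<^sub>\<infinity>j\<in>J. S j)))"
proof -
  have f: "reaction f"
    using assms by (auto simp: ignition_def general_KPP_def)
  obtain G g g' :: "real \<Rightarrow> real" and \<delta> D :: real where
    "\<forall>z. (G has_real_derivative g z) (at z)" "\<forall>z. (g has_real_derivative g' z) (at z)" and
    g': "continuous_on UNIV g'" and "\<forall>z. 0 \<le> g z \<and> g z \<le> 1" "\<forall>z. \<bar>g' z\<bar> \<le> D" and
    \<delta>: "\<delta> > 0" and "\<forall>z\<in>{0..1}. \<delta> * g z \<le> f z" and G01: "G 0 < G 1"
    by (rule reaction_cutoff[OF f])
  then have G: "\<And>z. (G has_real_derivative g z) (at z)" and g: "\<And>z. (g has_real_derivative g' z) (at z)" and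
    g_range: "\<And>z. 0 \<le> g z \<and> g z \<le> 1" and g'_le: "\<And>z. \<bar>g' z\<bar> \<le> D" and
    gf: "\<And>z. z \<in> {0..1} \<Longrightarrow> \<delta> * g z \<le> f z"
    by simp_all
  have cg: "continuous_on UNIV g"
    by (rule DERIV_continuous_on, rule g)
  define \<gamma> where "\<gamma> = G 1 - G 0"
  \<comment> \<open>These are the constants of \<open>laminar_bound\<close> and
    \<open>interval_sum_bound\<close> divided by \<open>\<gamma>\<close>; they are fixed before
    \<open>\<kappa>\<close>, \<open>v\<^sub>0\<close>, \<open>H\<close> and \<open>u\<close>
    appear.\<close>
  define M\<^sub>1 where "M\<^sub>1 = (1 + 1 / \<delta>) / 2 * (3 / 2) / \<gamma>"
  define M\<^sub>2 where "M\<^sub>2 = 8 * (\<gamma> + 3 / 2 * (1 + D + 2 * (1 + 1 / \<delta>))) / \<gamma>"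
  have \<gamma>: "\<gamma> > 0"
    using G01 by (simp add: \<gamma>_def)
  have "D \<ge> 0"
    using g'_le[of 0] by linarith
  then have M: "M\<^sub>1 > 0" "M\<^sub>2 > 0"
    unfolding M\<^sub>1_def M\<^sub>2_def using \<gamma> \<delta> by (auto intro!: divide_pos_pos mult_pos_pos add_pos_nonneg)
  show ?thesis
  proof (intro exI[of _ "1 / (M\<^sub>1 + M\<^sub>2)"] conjI allI impI; (elim conjE)?)
    show "0 < 1 / (M\<^sub>1 + M\<^sub>2)"
      using M by simp
  next
    fix \<kappa> v\<^sub>0 H c :: real and u :: "real \<Rightarrow> real" and U :: "real \<Rightarrow> real \<Rightarrow> real"
      and J :: "nat set" and m h :: "nat \<Rightarrow> real"
    assume pos: "\<kappa> > 0" "v\<^sub>0 > 0" "H > 0" and u: "C1_on {0..H} u" "integral {0..H} u = 0"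
      and front: "traveling_front \<kappa> v\<^sub>0 H u f c U" and adm: "admissible_intervals H u J m h"
    define S where "S j = inverse (1 + \<kappa> / v\<^sub>0 / h j) *
        (integral {m j - h j..m j + h j} (\<lambda>y. \<bar>u y\<bar>) / H)" for j
    define N where "N j = (SUP y\<in>{m j - h j<..<m j + h j}. \<bar>u y\<bar>)" for j
    have disj: "disjoint_family_on (\<lambda>j. {m j - h j<..<m j + h j}) J"
      and h: "\<And>j. j \<in> J \<Longrightarrow> h j > 0"
      and sub: "\<And>j. j \<in> J \<Longrightarrow> {m j - h j<..<m j + h j} \<subseteq> {0..H}"
      and N: "\<And>j y. j \<in> J \<Longrightarrow> y \<in> {m j - h j<..<m j + h j} \<Longrightarrow> N j / 2 \<le> \<bar>u y\<bar> \<and> \<bar>u y\<bar> \<le> N j"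
      using adm unfolding admissible_intervals_def Let_def N_def by auto
    obtain Us Uy Uss Uyy where "front_profile \<kappa> v\<^sub>0 H c u f U Us Uy Uss Uyy"
      by (rule traveling_front_profile[OF pos u front f])
    then interpret front_profile \<kappa> v\<^sub>0 H c u f U Us Uy Uss Uyy .
    have "v\<^sub>0 * \<gamma> \<le> (1 + 1 / \<delta>) / 2 * (3 / 2 * c)"
      unfolding \<gamma>_def by (rule laminar_bound[OF G cg g_range \<delta> gf])
    then have "v\<^sub>0 \<le> (1 + 1 / \<delta>) / 2 * (3 / 2 * c) / \<gamma>"
      by (simp only: pos_le_divide_eq[OF \<gamma>])
    then have laminar: "v\<^sub>0 \<le> M\<^sub>1 * c"
      by (simp only: M\<^sub>1_def times_divide_eq_left times_divide_eq_right mult.assoc)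
    \<comment> \<open>The sign of the speed comes from the laminar bound, since
      \<open>v\<^sub>0 > 0\<close>, and is an input to \<open>interval_sum_bound\<close>.\<close>
    then have c: "c \<ge> 0"
      using M(1) pos(2) by (smt (verit) mult_nonneg_nonpos)
    have S_nonneg: "0 \<le> S j" if "j \<in> J" for j
    proof -
      have "0 \<le> integral {m j - h j..m j + h j} (\<lambda>y. \<bar>u y\<bar>)"
        by (cases "(\<lambda>y. \<bar>u y\<bar>) integrable_on {m j - h j..m j + h j}")
           (auto intro: Henstock_Kurzweil_Integration.integral_nonneg simp: not_integrable_integral)
      then show ?thesis
        using pos h[OF that] by (simp add: S_def)
    qed
    \<comment> \<open>The bound is the same for every finite \<open>F\<close>, so it yields both the
      convergence of the nonnegative series and the estimate of its sum.\<close>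
    have S_sum: "sum S F \<le> M\<^sub>2 * c" if F: "finite F" "F \<subseteq> J" for F
    proof -
      have "\<gamma> * sum S F \<le> 8 * (\<gamma> + 3 / 2 * (1 + D + 2 * (1 + 1 / \<delta>))) * c"
        unfolding \<gamma>_def S_def
        by (rule interval_sum_bound[where N = N, OF F(1) disjoint_family_on_mono[OF F(2) disj]
              _ _ _ G g g' g_range g'_le \<delta> gf c])
           (use F(2) h sub N G01 in auto)
      then show ?thesis
        unfolding M\<^sub>2_def times_divide_eq_left pos_le_divide_eq[OF \<gamma>] by (simp only: mult.commute)
    qed
    have summable: "S summable_on J"
      by (rule nonneg_bdd_above_summable_on) (auto intro!: bdd_aboveI2 S_nonneg S_sum)
    have "(\<Sum>\<^sub>\<infinity>j\<in>J. S j) \<le> M\<^sub>2 * c"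
      by (rule infsum_le_finite_sums[OF summable S_sum])
    with laminar have "v\<^sub>0 + (\<Sum>\<^sub>\<infinity>j\<in>J. S j) \<le> (M\<^sub>1 + M\<^sub>2) * c"
      by (simp add: distrib_right)
    then have "1 / (M\<^sub>1 + M\<^sub>2) * (v\<^sub>0 + (\<Sum>\<^sub>\<infinity>j\<in>J. S j)) \<le> c"
      using M by (simp add: divide_le_eq mult.commute)
    with summable show "let l = \<kappa> / v\<^sub>0;
          S = (\<lambda>j. inverse (1 + l / h j) * (integral {m j - h j..m j + h j} (\<lambda>y. \<bar>u y\<bar>) / H))
        in S summable_on J \<and> c \<ge> 1 / (M\<^sub>1 + M\<^sub>2) * (v\<^sub>0 + (\<Sum>\<^sub>\<infinity>j\<in>J. S j))"
      unfolding Let_def S_def[abs_def] by blast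
  qed
qed

end
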